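(* Let $a\in L^\infty_{\mathrm{loc}}([0,\infty))$ with $a(x)\ge 0$ for almost all $x>0$, let $b:(0,\infty)^2\to[0,\infty)$ be measurable with $b(x,y)=0$ for almost all $x,y$ with $x>y$, and let $\omega:[0,\infty)\to[0,\infty)$ be measurable. Assume that there exists $\kappa\in(0,1]$ such that $$\int_0^y b(x,y)\omega(x)\,\mathrm{d}x\le\kappa\,\omega(y)\qquad\text{for all } y>0.$$ Let $c:[0,\infty)\to\mathbb{R}$ be non-decreasing with $a(x)\le c(x)$ for almost every $x\in[0,\infty)$, and set $\widetilde\omega=(1+c)\omega$. Let $(S^{(\omega)}(t))_{t\ge0}$ be the substochastic $C_0$-semigroup on $X_\omega$ generated by $G^{(\omega)}=\overline{A^{(\omega)}+B^{(\omega)}}$, with $A^{(\omega)}$, $B^{(\omega)}$ as in the context. Then, for every $\mathring{u}\in X_{\widetilde\omega}$, the function $u(t)=S^{(\omega)}(t)\mathring{u}$ is the unique classical solution of the abstract Cauchy problem $$\frac{\mathrm{d}u}{\mathrm{d}t}=A^{(\omega)}u+B^{(\omega)}u,\quad t>0;\qquad u(0)=\mathring{u}.$$ If $\mathring{u}\in (X_{\widetilde\omega})_+$, then this solution is non-negative.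
   Context: For a non-negative measurable function $\omega$ on $[0,\infty)$, $X_\omega = L^1((0,\infty),\omega(x)\,\mathrm{d}x)$ is the real Banach space with norm $\|f\|_\omega=\int_0^\infty|f(x)|\omega(x)\,\mathrm{d}x$, ordered by the pointwise almost-everywhere order; $X_{\widetilde\omega}$ is defined in the same way with $\widetilde\omega$ in place of $\omega$, and $(X_{\widetilde\omega})_+$ is the set of its non-negative elements. The operators in $X_\omega$ are $A^{(\omega)}f=-af$ with domain $\mathcal{D}(A^{(\omega)})=\{f\in X_\omega: af\in X_\omega\}$, and $(B^{(\omega)}f)(x)=\int_x^\infty a(y)b(x,y)f(y)\,\mathrm{d}y$ for $x>0$, with domain $\mathcal{D}(B^{(\omega)})=\{f\in X_\omega: B^{(\omega)}f\in X_\omega\}$. The sum $A^{(\omega)}+B^{(\omega)}$ has domain $\mathcal{D}(A^{(\omega)})\cap\mathcal{D}(B^{(\omega)})$, and $\overline{A^{(\omega)}+B^{(\omega)}}$ denotes its closure. Under the stated hypotheses it is known that this closure exists and generates a substochastic $C_0$-semigroup (i.e. a positive $C_0$-semigroup of contractions) on $X_\omega$ that leaves $X_{\widetilde\omega}$ invariant. A classical solution of $u'=Lu$ ($t>0$), $u(0)=\mathring{u}$, for a linear operator $L$ in $X_\omega$, is a function $u:[0,\infty)\to X_\omega$ that is continuous on $[0,\infty)$, continuously differentiable on $(0,\infty)$, satisfies $u(t)\in\mathcal{D}(L)$ for $t>0$, and satisfies the equation for $t>0$ and the initial condition. Here $L=A^{(\omega)}+B^{(\omega)}$. *)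

theory Defs
  imports "HOL-Analysis.Analysis"
begin

text \<open>
  Elements of an \<open>L\<^sup>1\<close> space are represented by integrable functions; two representatives denote
  the same element iff they agree almost everywhere with respect to the underlying measure.
  The weight \<open>\<omega>\<close> used below may vanish on sets of positive Lebesgue measure; there the values of
  a representative are irrelevant.
\<close>

definition L1 :: "'a measure \<Rightarrow> ('a \<Rightarrow> real) set" where
  "L1 M = {f. integrable M f}"

definition L1_pos :: "'a measure \<Rightarrow> ('a \<Rightarrow> real) set" where
  "L1_pos M = {f \<in> L1 M. AE x in M. 0 \<le> f x}"

definition L1_norm :: "'a measure \<Rightarrow> ('a \<Rightarrow> real) \<Rightarrow> real" where
  "L1_norm M f = (\<integral>x. \<bar>f x\<bar> \<partial>M)"

text \<open>The Bochner integral of a non-integrable function is 0, so convergence in norm is only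
  meaningful for members of \<^term>\<open>L1 M\<close>; membership is required wherever it is used.\<close>

definition L1_tendsto ::
  "'a measure \<Rightarrow> ('i \<Rightarrow> 'a \<Rightarrow> real) \<Rightarrow> ('a \<Rightarrow> real) \<Rightarrow> 'i filter \<Rightarrow> bool" where
  "L1_tendsto M u f F \<longleftrightarrow> ((\<lambda>s. L1_norm M (\<lambda>x. u s x - f x)) \<longlongrightarrow> 0) F"

definition L1_continuous_on :: "'a measure \<Rightarrow> real set \<Rightarrow> (real \<Rightarrow> 'a \<Rightarrow> real) \<Rightarrow> bool" where
  "L1_continuous_on M I u \<longleftrightarrow>
     (\<forall>t\<in>I. u t \<in> L1 M) \<and> (\<forall>t\<in>I. L1_tendsto M u (u t) (at t within I))"

definition L1_has_derivative_at ::
  "'a measure \<Rightarrow> (real \<Rightarrow> 'a \<Rightarrow> real) \<Rightarrow> ('a \<Rightarrow> real) \<Rightarrow> real \<Rightarrow> bool" where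
  "L1_has_derivative_at M u g t \<longleftrightarrow>
     g \<in> L1 M \<and> L1_tendsto M (\<lambda>s x. (u s x - u t x) / (s - t)) g (at t)"

text \<open>A linear operator in \<^term>\<open>L1 M\<close> is given by its domain \<open>D\<close> and its action \<open>L\<close>; its graph
  contains all representatives of the values.\<close>

definition op_graph ::
  "'a measure \<Rightarrow> ('a \<Rightarrow> real) set \<Rightarrow> (('a \<Rightarrow> real) \<Rightarrow> 'a \<Rightarrow> real) \<Rightarrow> (('a \<Rightarrow> real) \<times> ('a \<Rightarrow> real)) set" where
  "op_graph M D L = {(f, g). f \<in> D \<and> g \<in> L1 M \<and> (AE x in M. g x = L f x)}"

definition graph_closure ::
  "'a measure \<Rightarrow> (('a \<Rightarrow> real) \<times> ('a \<Rightarrow> real)) set \<Rightarrow> (('a \<Rightarrow> real) \<times> ('a \<Rightarrow> real)) set" where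
  "graph_closure M T = {(f, g). f \<in> L1 M \<and> g \<in> L1 M \<and>
     (\<exists>F G. (\<forall>n::nat. (F n, G n) \<in> T) \<and>
            L1_tendsto M F f sequentially \<and> L1_tendsto M G g sequentially)}"

text \<open>Linearity together with boundedness forces each \<open>S t\<close> to respect almost everywhere equality.\<close>

definition C0_semigroup :: "'a measure \<Rightarrow> (real \<Rightarrow> ('a \<Rightarrow> real) \<Rightarrow> 'a \<Rightarrow> real) \<Rightarrow> bool" where
  "C0_semigroup M S \<longleftrightarrow>
     (\<forall>t\<ge>0. \<forall>f\<in>L1 M. S t f \<in> L1 M) \<and>
     (\<forall>t\<ge>0. \<forall>f\<in>L1 M. \<forall>g\<in>L1 M. \<forall>\<alpha> \<beta>.
        AE x in M. S t (\<lambda>z. \<alpha> * f z + \<beta> * g z) x = \<alpha> * S t f x + \<beta> * S t g x) \<and>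
     (\<forall>t\<ge>0. \<exists>C. \<forall>f\<in>L1 M. L1_norm M (S t f) \<le> C * L1_norm M f) \<and>
     (\<forall>f\<in>L1 M. AE x in M. S 0 f x = f x) \<and>
     (\<forall>s\<ge>0. \<forall>t\<ge>0. \<forall>f\<in>L1 M. AE x in M. S (s + t) f x = S s (S t f) x) \<and>
     (\<forall>f\<in>L1 M. L1_tendsto M (\<lambda>t. S t f) f (at_right 0))"

definition substochastic_semigroup ::
  "'a measure \<Rightarrow> (real \<Rightarrow> ('a \<Rightarrow> real) \<Rightarrow> 'a \<Rightarrow> real) \<Rightarrow> bool" where
  "substochastic_semigroup M S \<longleftrightarrow>
     C0_semigroup M S \<and>
     (\<forall>t\<ge>0. \<forall>f\<in>L1_pos M. S t f \<in> L1_pos M) \<and>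
     (\<forall>t\<ge>0. \<forall>f\<in>L1 M. L1_norm M (S t f) \<le> L1_norm M f)"

definition generator_graph ::
  "'a measure \<Rightarrow> (real \<Rightarrow> ('a \<Rightarrow> real) \<Rightarrow> 'a \<Rightarrow> real) \<Rightarrow> (('a \<Rightarrow> real) \<times> ('a \<Rightarrow> real)) set" where
  "generator_graph M S = {(f, g). f \<in> L1 M \<and> g \<in> L1 M \<and>
     L1_tendsto M (\<lambda>h x. (S h f x - f x) / h) g (at_right 0)}"

definition classical_solution ::
  "'a measure \<Rightarrow> ('a \<Rightarrow> real) set \<Rightarrow> (('a \<Rightarrow> real) \<Rightarrow> 'a \<Rightarrow> real) \<Rightarrow> ('a \<Rightarrow> real) \<Rightarrow>
     (real \<Rightarrow> 'a \<Rightarrow> real) \<Rightarrow> bool" where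
  "classical_solution M D L u0 u \<longleftrightarrow>
     L1_continuous_on M {0..} u \<and>
     (\<exists>u'. (\<forall>t>0. L1_has_derivative_at M u (u' t) t) \<and>
           L1_continuous_on M {0<..} u' \<and>
           (\<forall>t>0. u t \<in> D \<and> (AE x in M. u' t x = L (u t) x))) \<and>
     (AE x in M. u 0 x = u0 x)"

definition unique_classical_solution ::
  "'a measure \<Rightarrow> ('a \<Rightarrow> real) set \<Rightarrow> (('a \<Rightarrow> real) \<Rightarrow> 'a \<Rightarrow> real) \<Rightarrow> ('a \<Rightarrow> real) \<Rightarrow>
     (real \<Rightarrow> 'a \<Rightarrow> real) \<Rightarrow> bool" where
  "unique_classical_solution M D L u0 u \<longleftrightarrow>
     classical_solution M D L u0 u \<and>
     (\<forall>v. classical_solution M D L u0 v \<longrightarrow> (\<forall>t\<ge>0. AE x in M. v t x = u t x))"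

text \<open>The measure \<open>\<omega>(x) dx\<close> on \<open>(0,\<infinity>)\<close>.\<close>

definition weighted :: "(real \<Rightarrow> real) \<Rightarrow> real measure" where
  "weighted \<omega> = density (lebesgue_on {0<..}) (\<lambda>x. ennreal (\<omega> x))"

abbreviation X :: "(real \<Rightarrow> real) \<Rightarrow> (real \<Rightarrow> real) set" where
  "X \<omega> \<equiv> L1 (weighted \<omega>)"

abbreviation X_pos :: "(real \<Rightarrow> real) \<Rightarrow> (real \<Rightarrow> real) set" where
  "X_pos \<omega> \<equiv> L1_pos (weighted \<omega>)"

definition L_inf_loc :: "(real \<Rightarrow> real) \<Rightarrow> bool" where
  "L_inf_loc a \<longleftrightarrow> a \<in> borel_measurable (lebesgue_on {0..}) \<and>
     (\<forall>K\<subseteq>{0..}. compact K \<longrightarrow> (\<exists>C. AE x in lebesgue_on K. \<bar>a x\<bar> \<le> C))"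

definition A_op :: "(real \<Rightarrow> real) \<Rightarrow> (real \<Rightarrow> real) \<Rightarrow> real \<Rightarrow> real" where
  "A_op a f = (\<lambda>x. - (a x * f x))"

definition A_dom :: "(real \<Rightarrow> real) \<Rightarrow> (real \<Rightarrow> real) \<Rightarrow> (real \<Rightarrow> real) set" where
  "A_dom \<omega> a = {f \<in> X \<omega>. (\<lambda>x. a x * f x) \<in> X \<omega>}"

definition B_op ::
  "(real \<Rightarrow> real) \<Rightarrow> (real \<Rightarrow> real \<Rightarrow> real) \<Rightarrow> (real \<Rightarrow> real) \<Rightarrow> real \<Rightarrow> real" where
  "B_op a b f = (\<lambda>x. LINT y:{x<..}|lebesgue. a y * b x y * f y)"

text \<open>\<open>B f \<in> X \<omega>\<close> includes that the integral defining \<open>(B f)(x)\<close> exists for almost every \<open>x\<close>;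
  this has to be said explicitly since the Bochner integral is total. \<open>B f\<close> does not depend on the
  representative of \<open>f\<close>, even where \<open>\<omega>\<close> vanishes, provided \<open>b(x,y) \<omega>(x) = 0\<close> for almost all \<open>x < y\<close>
  whenever \<open>\<omega>(y) = 0\<close>.\<close>

definition B_dom ::
  "(real \<Rightarrow> real) \<Rightarrow> (real \<Rightarrow> real) \<Rightarrow> (real \<Rightarrow> real \<Rightarrow> real) \<Rightarrow> (real \<Rightarrow> real) set" where
  "B_dom \<omega> a b = {f \<in> X \<omega>.
     (AE x in weighted \<omega>. set_integrable lebesgue {x<..} (\<lambda>y. a y * b x y * f y)) \<and>
     B_op a b f \<in> X \<omega>}"

definition AB_op ::
  "(real \<Rightarrow> real) \<Rightarrow> (real \<Rightarrow> real \<Rightarrow> real) \<Rightarrow> (real \<Rightarrow> real) \<Rightarrow> real \<Rightarrow> real" where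
  "AB_op a b f = (\<lambda>x. A_op a f x + B_op a b f x)"

definition AB_dom ::
  "(real \<Rightarrow> real) \<Rightarrow> (real \<Rightarrow> real) \<Rightarrow> (real \<Rightarrow> real \<Rightarrow> real) \<Rightarrow> (real \<Rightarrow> real) set" where
  "AB_dom \<omega> a b = A_dom \<omega> a \<inter> B_dom \<omega> a b"

end

theory Submission
  imports Defs
begin

text \<open>
  On functions supported in a bounded interval the operator \<open>A + B\<close> is bounded, leaves the support
  bounded, and the forward Euler step \<open>1 + h (A + B)\<close> is, for small \<open>h\<close>, a contraction for every
  weight \<open>w\<close> with \<open>\<integral> b(x,y) w(x) dx \<le> w(y)\<close>. Since \<open>c\<close> is monotone, \<open>(1 + c) \<omega>\<close> is such a weight
  along with \<open>\<omega>\<close>. Euler steps converge to \<open>S t u0\<close> in \<open>X \<omega>\<close>, so that \<open>S t\<close> leaves \<open>X ((1 + c) \<omega>)\<close>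
  invariant by truncation and Fatou's lemma. As \<open>a \<le> c\<close>, this space is contained in the domain of
  \<open>A + B\<close>, which makes \<open>S t u0\<close> a classical solution. Uniqueness holds because \<open>s \<mapsto> S (t - s) (v s)\<close>
  has derivative zero for every classical solution \<open>v\<close>.
\<close>

section \<open>Calculus in \<open>L\<^sup>1\<close>\<close>

lemma L1_norm_nonneg [simp]: "0 \<le> L1_norm M f"
  by (simp add: L1_norm_def)

text \<open>The hypotheses describe \<open>S\<close> only through its generator, which is a closure,
  and say nothing about how \<open>S t\<close> acts on the smaller space. Euler iterates are
  explicit and do not mention the weight, so one and the same function can be measured in both
  norms: convergence is needed in \<open>X \<omega>\<close> only, while in
  \<open>X ((1 + c) \<omega>)\<close> stability is enough. Stability is a balance of mass. If
  \<open>h * a \<le> 1\<close>, the loss term lowers the norm by exactly \<open>h\<close> times the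
  norm of \<open>a f\<close>, and the gain term returns at most that much; a non-decreasing factor
  in the weight does no harm, since the fragments of a particle are smaller than the particle. The
  obstacle is that \<open>a\<close> may be unbounded, so that no single step size serves all of the
  half-line. But \<open>B\<close> moves mass only towards smaller sizes, so the functions vanishing
  beyond \<open>N\<close> form an invariant space on which \<open>a\<close> is essentially bounded.
  The admissible step size depends on \<open>N\<close>, the resulting norm bound does not, and this
  uniformity is what survives the limit.\<close>

lemma L1_diff [intro]: "f \<in> L1 M \<Longrightarrow> g \<in> L1 M \<Longrightarrow> (\<lambda>x. f x - g x) \<in> L1 M"
  and L1_add [intro]: "f \<in> L1 M \<Longrightarrow> g \<in> L1 M \<Longrightarrow> (\<lambda>x. f x + g x) \<in> L1 M"
  and L1_scale [intro]: "f \<in> L1 M \<Longrightarrow> (\<lambda>x. r * f x) \<in> L1 M"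
  and L1_divide [intro]: "f \<in> L1 M \<Longrightarrow> (\<lambda>x. f x / r) \<in> L1 M"
  by (auto simp: L1_def)

lemma zero_L1 [simp]: "(\<lambda>x. 0) \<in> L1 M"
  by (simp add: L1_def)

text \<open>The triangle inequality in the form of a domination, so that identities known only
  almost everywhere can be inserted before the estimate.\<close>

lemma L1_norm_le_add:
  assumes "f \<in> L1 M" "g \<in> L1 M" "h \<in> L1 M" "AE x in M. \<bar>h x\<bar> \<le> \<bar>f x\<bar> + \<bar>g x\<bar>"
  shows "L1_norm M h \<le> L1_norm M f + L1_norm M g"
proof -
  have "L1_norm M h \<le> (\<integral>x. \<bar>f x\<bar> + \<bar>g x\<bar> \<partial>M)"
    unfolding L1_norm_def using assms by (intro integral_mono_AE) (auto simp: L1_def)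
  also have "\<dots> = L1_norm M f + L1_norm M g"
    unfolding L1_norm_def using assms by (subst Bochner_Integration.integral_add) (auto simp: L1_def)
  finally show ?thesis .
qed

lemma L1_norm_mono:
  assumes "f \<in> L1 M" "g \<in> L1 M" "AE x in M. \<bar>f x\<bar> \<le> \<bar>g x\<bar>"
  shows "L1_norm M f \<le> L1_norm M g"
  unfolding L1_norm_def using assms by (intro integral_mono_AE) (auto simp: L1_def)

lemma L1_norm_cong:
  assumes "f \<in> L1 M" "g \<in> L1 M" "AE x in M. f x = g x"
  shows "L1_norm M f = L1_norm M g"
  by (rule antisym; rule L1_norm_mono) (use assms in auto)

lemma L1_norm_scale: "L1_norm M (\<lambda>x. r * f x) = \<bar>r\<bar> * L1_norm M f"
  unfolding L1_norm_def by (simp add: abs_mult)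

lemma L1_norm_eq_0_AE:
  assumes "f \<in> L1 M" "L1_norm M f = 0"
  shows "AE x in M. f x = 0"
  using assms integral_nonneg_eq_0_iff_AE[of M "\<lambda>x. \<bar>f x\<bar>"] by (auto simp: L1_def L1_norm_def)

lemma L1_tendsto_bound:
  assumes "\<forall>\<^sub>F s in F. L1_norm M (\<lambda>x. u s x - f x) \<le> g s" "(g \<longlongrightarrow> 0) F"
  shows "L1_tendsto M u f F"
  unfolding L1_tendsto_def by (rule tendsto_sandwich[OF _ assms(1) tendsto_const assms(2)]) simp

text \<open>Eventual membership of \<open>u s\<close> in \<open>L1 M\<close> matters: for a
  non-integrable difference the norm is 0 by default, and convergence would then carry no
  information about the limit.\<close>

lemma L1_tendsto_unique:
  assumes "L1_tendsto M u f F" "L1_tendsto M u g F" "F \<noteq> bot"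
    and "\<forall>\<^sub>F s in F. u s \<in> L1 M" "f \<in> L1 M" "g \<in> L1 M"
  shows "AE x in M. f x = g x"
proof -
  have "((\<lambda>s. L1_norm M (\<lambda>x. u s x - f x) + L1_norm M (\<lambda>x. u s x - g x)) \<longlongrightarrow> 0 + 0) F"
    using assms(1,2) unfolding L1_tendsto_def by (rule tendsto_add)
  moreover have "\<forall>\<^sub>F s in F. L1_norm M (\<lambda>x. f x - g x)
      \<le> L1_norm M (\<lambda>x. u s x - f x) + L1_norm M (\<lambda>x. u s x - g x)"
    using assms(4)
  proof eventually_elim
    case (elim s)
    show ?case by (rule L1_norm_le_add) (use elim assms in auto)
  qed
  ultimately have "L1_norm M (\<lambda>x. f x - g x) \<le> 0"
    using tendsto_lowerbound[OF _ _ assms(3)] by fastforce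
  then have "L1_norm M (\<lambda>x. f x - g x) = 0" by (simp add: antisym)
  from L1_norm_eq_0_AE[OF L1_diff[OF assms(5,6)] this] show ?thesis by simp
qed

section \<open>Duality with bounded measurable functions\<close>

definition pairing :: "'a measure \<Rightarrow> ('a \<Rightarrow> real) \<Rightarrow> ('a \<Rightarrow> real) \<Rightarrow> real" where
  "pairing M \<phi> f = (\<integral>x. \<phi> x * f x \<partial>M)"

text \<open>Stands in for the unit ball of the dual space. The bound is imposed at every point, so
  that no exceptional null set has to be carried along.\<close>

definition unit_test :: "'a measure \<Rightarrow> ('a \<Rightarrow> real) \<Rightarrow> bool" where
  "unit_test M \<phi> \<longleftrightarrow> \<phi> \<in> borel_measurable M \<and> (\<forall>x. \<bar>\<phi> x\<bar> \<le> 1)"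

lemma pairing_integrable:
  assumes "unit_test M \<phi>" "f \<in> L1 M"
  shows "integrable M (\<lambda>x. \<phi> x * f x)"
  by (rule Bochner_Integration.integrable_bound[of M f])
    (use assms in \<open>auto simp: L1_def unit_test_def abs_mult intro!: mult_left_le_one_le\<close>)

lemma abs_pairing_le:
  assumes "unit_test M \<phi>" "f \<in> L1 M"
  shows "\<bar>pairing M \<phi> f\<bar> \<le> L1_norm M f"
proof -
  have "\<bar>pairing M \<phi> f\<bar> \<le> (\<integral>x. \<bar>\<phi> x * f x\<bar> \<partial>M)"
    unfolding pairing_def by (rule integral_abs_bound)
  also have "\<dots> \<le> L1_norm M f"
    unfolding L1_norm_def
  proof (rule integral_mono)
    show "integrable M (\<lambda>x. \<bar>\<phi> x * f x\<bar>)" "integrable M (\<lambda>x. \<bar>f x\<bar>)"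
      using pairing_integrable[OF assms] assms by (auto simp: L1_def)
    show "\<bar>\<phi> x * f x\<bar> \<le> \<bar>f x\<bar>" for x
      using assms by (auto simp: unit_test_def abs_mult intro!: mult_left_le_one_le)
  qed
  finally show ?thesis .
qed

lemma pairing_diff:
  assumes "unit_test M \<phi>" "f \<in> L1 M" "g \<in> L1 M"
  shows "pairing M \<phi> (\<lambda>x. f x - g x) = pairing M \<phi> f - pairing M \<phi> g"
  unfolding pairing_def
  using pairing_integrable[OF assms(1,2)] pairing_integrable[OF assms(1,3)]
  by (simp add: right_diff_distrib)

lemma pairing_divide: "pairing M \<phi> (\<lambda>x. f x / r) = pairing M \<phi> f / r"
  unfolding pairing_def by simp

text \<open>The sign of \<open>f\<close> attains the norm; this explicit functional takes the place
  of Hahn-Banach in the mean value inequality.\<close>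

lemma ex_norming_test:
  assumes "f \<in> L1 M"
  obtains \<phi> where "unit_test M \<phi>" "pairing M \<phi> f = L1_norm M f"
proof
  show "unit_test M (\<lambda>x. sgn (f x))"
    using assms by (auto simp: L1_def unit_test_def sgn_if)
  show "pairing M (\<lambda>x. sgn (f x)) f = L1_norm M f"
    unfolding pairing_def L1_norm_def by (simp add: mult.commute[of "sgn _"] abs_sgn[symmetric])
qed

lemma pairing_tendsto:
  assumes "L1_tendsto M u f F" "\<forall>\<^sub>F s in F. u s \<in> L1 M" "f \<in> L1 M" "unit_test M \<phi>"
  shows "((\<lambda>s. pairing M \<phi> (u s)) \<longlongrightarrow> pairing M \<phi> f) F"
proof (rule LIM_zero_cancel, rule Lim_null_comparison)
  show "((\<lambda>s. L1_norm M (\<lambda>x. u s x - f x)) \<longlongrightarrow> 0) F"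
    using assms(1) by (simp add: L1_tendsto_def)
  show "\<forall>\<^sub>F s in F. norm (pairing M \<phi> (u s) - pairing M \<phi> f) \<le> L1_norm M (\<lambda>x. u s x - f x)"
    using assms(2)
  proof eventually_elim
    case (elim s)
    then show ?case
      using abs_pairing_le[OF assms(4) L1_diff[OF elim assms(3)]]
      by (simp add: pairing_diff assms)
  qed
qed

lemma pairing_has_derivative:
  assumes "L1_has_derivative_at M u g t" "\<forall>\<^sub>F s in at t. u s \<in> L1 M" "u t \<in> L1 M" "unit_test M \<phi>"
  shows "((\<lambda>s. pairing M \<phi> (u s)) has_real_derivative pairing M \<phi> g) (at t)"
proof -
  have "((\<lambda>s. pairing M \<phi> (\<lambda>x. (u s x - u t x) / (s - t))) \<longlongrightarrow> pairing M \<phi> g) (at t)"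
    by (rule pairing_tendsto)
      (use assms in \<open>auto simp: L1_has_derivative_at_def elim!: eventually_mono\<close>)
  moreover have "\<forall>\<^sub>F s in at t. pairing M \<phi> (\<lambda>x. (u s x - u t x) / (s - t))
      = (pairing M \<phi> (u s) - pairing M \<phi> (u t)) / (s - t)"
    using assms(2)
    by eventually_elim (simp add: pairing_divide pairing_diff[OF assms(4) _ assms(3)])
  ultimately have "((\<lambda>s. (pairing M \<phi> (u s) - pairing M \<phi> (u t)) / (s - t)) \<longlongrightarrow> pairing M \<phi> g) (at t)"
    by (rule Lim_transform_eventually)
  then show ?thesis
    by (simp add: has_field_derivative_iff)
qed

text \<open>Pairing with the sign of the increment reduces the vector-valued statement to the real one.\<close>

lemma L1_mean_value:
  fixes u u' :: "real \<Rightarrow> 'a \<Rightarrow> real"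
  assumes "0 < T" "L1_continuous_on M {0..T} u"
    and der: "\<And>t. 0 < t \<Longrightarrow> t < T \<Longrightarrow> L1_has_derivative_at M u (u' t) t"
    and bound: "\<And>t. 0 < t \<Longrightarrow> t < T \<Longrightarrow> L1_norm M (u' t) \<le> C"
  shows "L1_norm M (\<lambda>x. u T x - u 0 x) \<le> C * T"
proof -
  have uL: "u t \<in> L1 M" if "t \<in> {0..T}" for t
    using assms(2) that by (auto simp: L1_continuous_on_def)
  obtain \<phi> where \<phi>: "unit_test M \<phi>"
    and eq: "pairing M \<phi> (\<lambda>x. u T x - u 0 x) = L1_norm M (\<lambda>x. u T x - u 0 x)"
    using ex_norming_test[OF L1_diff[OF uL uL]] assms(1) by (metis atLeastAtMost_iff less_imp_le order_refl)
  define p where "p = (\<lambda>s. pairing M \<phi> (u s))"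
  have "continuous_on {0..T} p"
    unfolding continuous_on_def p_def
  proof
    fix t assume t: "t \<in> {0..T}"
    show "((\<lambda>s. pairing M \<phi> (u s)) \<longlongrightarrow> pairing M \<phi> (u t)) (at t within {0..T})"
      using assms(2) t uL \<phi>
      by (intro pairing_tendsto) (auto simp: L1_continuous_on_def eventually_at_filter)
  qed
  moreover have pd: "(p has_real_derivative pairing M \<phi> (u' t)) (at t)" if "0 < t" "t < T" for t
    unfolding p_def
  proof (rule pairing_has_derivative[OF der[OF that]])
    have "\<forall>\<^sub>F s in at t. s \<in> {0<..<T}"
      using that by (intro eventually_at_in_open') auto
    then show "\<forall>\<^sub>F s in at t. u s \<in> L1 M"
      by eventually_elim (use uL in auto)
  qed (use that uL \<phi> in auto)
  ultimately obtain l z where z: "0 < z" "z < T" "(p has_real_derivative l) (at z)" "p T - p 0 = (T - 0) * l"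
    using MVT[OF assms(1), of p] by (metis real_differentiable_def)
  have "l = pairing M \<phi> (u' z)"
    using pd[OF z(1,2)] z(3) DERIV_unique by blast
  then have "l \<le> C"
    using abs_pairing_le[OF \<phi>, of "u' z"] der[OF z(1,2)] bound[OF z(1,2)]
    by (auto simp: L1_has_derivative_at_def)
  then have "p T - p 0 \<le> C * T"
    using z(4) assms(1) by (simp add: mult.commute)
  then show ?thesis
    using eq assms(1) by (simp add: p_def pairing_diff[OF \<phi> uL uL])
qed

section \<open>Substochastic semigroups\<close>

locale substochastic =
  fixes M :: "'a measure" and S :: "real \<Rightarrow> ('a \<Rightarrow> real) \<Rightarrow> 'a \<Rightarrow> real"
  assumes substochastic: "substochastic_semigroup M S"
begin

lemma S_L1 [intro]: "0 \<le> t \<Longrightarrow> f \<in> L1 M \<Longrightarrow> S t f \<in> L1 M"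
  using substochastic by (simp add: substochastic_semigroup_def C0_semigroup_def)

lemma S_lincomb:
  assumes "0 \<le> t" "f \<in> L1 M" "g \<in> L1 M"
  shows "AE x in M. S t (\<lambda>z. \<alpha> * f z + \<beta> * g z) x = \<alpha> * S t f x + \<beta> * S t g x"
  using substochastic assms by (simp add: substochastic_semigroup_def C0_semigroup_def)

lemma S_norm_le: "0 \<le> t \<Longrightarrow> f \<in> L1 M \<Longrightarrow> L1_norm M (S t f) \<le> L1_norm M f"
  using substochastic by (simp add: substochastic_semigroup_def)

lemma S_0: "f \<in> L1 M \<Longrightarrow> AE x in M. S 0 f x = f x"
  using substochastic by (simp add: substochastic_semigroup_def C0_semigroup_def)

lemma S_add: "0 \<le> s \<Longrightarrow> 0 \<le> t \<Longrightarrow> f \<in> L1 M \<Longrightarrow> AE x in M. S (s + t) f x = S s (S t f) x"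
  using substochastic by (simp add: substochastic_semigroup_def C0_semigroup_def)

lemma S_pos: "0 \<le> t \<Longrightarrow> f \<in> L1_pos M \<Longrightarrow> S t f \<in> L1_pos M"
  using substochastic by (simp add: substochastic_semigroup_def)

lemma S_tendsto_0: "f \<in> L1 M \<Longrightarrow> L1_tendsto M (\<lambda>t. S t f) f (at_right 0)"
  using substochastic by (simp add: substochastic_semigroup_def C0_semigroup_def)

lemma S_diff:
  assumes "0 \<le> t" "f \<in> L1 M" "g \<in> L1 M"
  shows "AE x in M. S t (\<lambda>z. f z - g z) x = S t f x - S t g x"
  using S_lincomb[OF assms, of 1 "-1"] by simp

lemma S_diff_norm_le:
  assumes "0 \<le> t" "f \<in> L1 M" "g \<in> L1 M"
  shows "L1_norm M (\<lambda>x. S t f x - S t g x) \<le> L1_norm M (\<lambda>x. f x - g x)"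
proof -
  have "L1_norm M (\<lambda>x. S t f x - S t g x) = L1_norm M (S t (\<lambda>x. f x - g x))"
    by (rule L1_norm_cong) (use assms S_diff[OF assms] in auto)
  also have "\<dots> \<le> L1_norm M (\<lambda>x. f x - g x)"
    by (rule S_norm_le) (use assms in auto)
  finally show ?thesis .
qed

text \<open>\<open>S t\<close> acts on representatives, so compatibility with almost everywhere
  equality is extracted from the contraction estimate, applied to a difference of norm zero.\<close>

lemma S_cong:
  assumes "0 \<le> t" "f \<in> L1 M" "g \<in> L1 M" "AE x in M. f x = g x"
  shows "AE x in M. S t f x = S t g x"
proof -
  have "L1_norm M (\<lambda>x. f x - g x) = L1_norm M (\<lambda>x. 0)"
    by (rule L1_norm_cong) (use assms in \<open>auto simp: L1_def\<close>)
  then have "L1_norm M (\<lambda>x. S t f x - S t g x) = 0"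
    using S_diff_norm_le[OF assms(1-3)] by (simp add: L1_norm_def antisym)
  moreover have "(\<lambda>x. S t f x - S t g x) \<in> L1 M" using assms by (auto intro!: L1_diff S_L1)
  ultimately show ?thesis using L1_norm_eq_0_AE by fastforce
qed

text \<open>The semigroup law pulls \<open>S (min s t)\<close> out of the increment and
  contractivity removes it. Writing the remaining time as \<open>\<bar>s - t\<bar>\<close> covers
  both orders, so that continuity from the right at 0 gives two-sided continuity at every
  time.\<close>

lemma S_increment_norm_le:
  assumes "0 \<le> s" "0 \<le> t" "f \<in> L1 M"
  shows "L1_norm M (\<lambda>x. S s f x - S t f x) \<le> L1_norm M (\<lambda>x. S \<bar>s - t\<bar> f x - f x)"
proof -
  have *: "L1_norm M (\<lambda>x. S s f x - S t f x) \<le> L1_norm M (\<lambda>x. S (s - t) f x - f x)"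
    if "0 \<le> t" "t \<le> s" for s t
  proof -
    have "L1_norm M (\<lambda>x. S s f x - S t f x) = L1_norm M (\<lambda>x. S t (S (s - t) f) x - S t f x)"
      using that assms S_add[of t "s - t" f] by (intro L1_norm_cong) (auto intro!: L1_diff S_L1)
    also have "\<dots> \<le> L1_norm M (\<lambda>x. S (s - t) f x - f x)"
      using that assms by (intro S_diff_norm_le) auto
    finally show ?thesis .
  qed
  have sym: "L1_norm M (\<lambda>x. S s f x - S t f x) = L1_norm M (\<lambda>x. S t f x - S s f x)"
    unfolding L1_norm_def by (simp add: abs_minus_commute)
  show ?thesis
    using *[of t s] *[of s t] assms sym by (cases "t \<le> s") auto
qed

lemma filterlim_abs_diff: "filterlim (\<lambda>s. \<bar>s - t\<bar>) (at_right (0::real)) (at t within I)"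
proof -
  have "((\<lambda>s. \<bar>s - t\<bar>) \<longlongrightarrow> \<bar>t - t\<bar>) (at t within I)"
    by (intro tendsto_intros)
  then show ?thesis
    by (auto simp: filterlim_at eventually_at_filter)
qed

lemma S_continuous_on: "f \<in> L1 M \<Longrightarrow> I \<subseteq> {0..} \<Longrightarrow> L1_continuous_on M I (\<lambda>t. S t f)"
  unfolding L1_continuous_on_def
proof (intro conjI ballI)
  fix t assume f: "f \<in> L1 M" and I: "I \<subseteq> {0..}" and t: "t \<in> I"
  then show "S t f \<in> L1 M" by auto
  have "((\<lambda>s. L1_norm M (\<lambda>x. S \<bar>s - t\<bar> f x - f x)) \<longlongrightarrow> 0) (at t within I)"
    using filterlim_compose[OF S_tendsto_0[OF f, unfolded L1_tendsto_def] filterlim_abs_diff] .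
  moreover have "\<forall>\<^sub>F s in at t within I. L1_norm M (\<lambda>x. S s f x - S t f x) \<le> L1_norm M (\<lambda>x. S \<bar>s - t\<bar> f x - f x)"
    using I t f by (auto simp: eventually_at_filter intro!: S_increment_norm_le always_eventually)
  ultimately show "L1_tendsto M (\<lambda>t. S t f) (S t f) (at t within I)"
    by (rule L1_tendsto_bound[rotated])
qed

section \<open>The generator and differentiability of orbits\<close>

lemma generator_L1:
  assumes "(f, g) \<in> generator_graph M S"
  shows "f \<in> L1 M" "g \<in> L1 M"
  using assms by (auto simp: generator_graph_def)

lemma generator_quotient_tendsto:
  assumes "(f, g) \<in> generator_graph M S"
  shows "((\<lambda>h. L1_norm M (\<lambda>x. (S h f x - f x) / h - g x)) \<longlongrightarrow> 0) (at_right 0)"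
  using assms by (auto simp: generator_graph_def L1_tendsto_def)

lemma generator_unique:
  assumes "(f, g) \<in> generator_graph M S" "(f, g') \<in> generator_graph M S"
  shows "AE x in M. g x = g' x"
proof (rule L1_tendsto_unique)
  show "\<forall>\<^sub>F h in at_right 0. (\<lambda>x. (S h f x - f x) / h) \<in> L1 M"
    using generator_L1[OF assms(1)]
    by (auto simp: eventually_at_filter intro!: always_eventually L1_divide L1_diff S_L1)
qed (use assms in \<open>auto simp: generator_graph_def\<close>)

text \<open>With \<open>m = min s t\<close> and \<open>h = \<bar>s - t\<bar>\<close> the quotient
  equals \<open>S m\<close> applied to the quotient at 0, whichever of \<open>s\<close>,
  \<open>t\<close> is larger. The first term is the error of that quotient, the second the price of
  replacing \<open>S m g\<close> by \<open>S t g\<close>, which is paid only for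
  \<open>s < t\<close>. This is how the one-sided limit defining the generator yields left
  derivatives as well.\<close>

lemma S_quotient_norm_le:
  assumes fg: "f \<in> L1 M" "g \<in> L1 M" and s: "0 \<le> s" "0 \<le> t" "s \<noteq> t"
  shows "L1_norm M (\<lambda>x. (S s f x - S t f x) / (s - t) - S t g x)
    \<le> L1_norm M (\<lambda>x. (S \<bar>s - t\<bar> f x - f x) / \<bar>s - t\<bar> - g x) + L1_norm M (\<lambda>x. S \<bar>s - t\<bar> g x - g x)"
proof -
  define h where "h = \<bar>s - t\<bar>"
  define m where "m = min s t"
  have h: "0 < h" and m: "0 \<le> m" using s by (auto simp: h_def m_def)
  define q where "q = (\<lambda>x. (S h f x - f x) / h - g x)"
  have q: "q \<in> L1 M" unfolding q_def using fg h by (auto intro!: L1_diff L1_divide S_L1)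
  have "AE x in M. S m (\<lambda>x. (1/h) * (S h f x - f x) + (-1) * g x) x
      = (1/h) * S m (\<lambda>x. S h f x - f x) x + (-1) * S m g x"
    by (rule S_lincomb) (use h m fg in \<open>auto intro!: L1_diff S_L1\<close>)
  moreover have "AE x in M. S m (\<lambda>x. S h f x - f x) x = S m (S h f) x - S m f x"
    by (rule S_diff) (use h m fg in auto)
  moreover have "AE x in M. S (m + h) f x = S m (S h f) x"
    by (rule S_add) (use h m fg in auto)
  moreover have "(\<lambda>x. (1/h) * (S h f x - f x) + (-1) * g x) = q"
    by (auto simp: q_def)
  ultimately have quot: "AE x in M. (S (m + h) f x - S m f x) / h = S m q x + S m g x"
    by (auto elim!: eventually_elim2 simp: field_simps)
  have mh: "(S s f x - S t f x) / (s - t) = (S (m + h) f x - S m f x) / h" for x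
    using s by (cases "s < t") (auto simp: m_def h_def min_def field_simps)
  have "L1_norm M (\<lambda>x. (S s f x - S t f x) / (s - t) - S t g x)
      \<le> L1_norm M (S m q) + L1_norm M (\<lambda>x. S m g x - S t g x)"
  proof (rule L1_norm_le_add)
    show "AE x in M. \<bar>(S s f x - S t f x) / (s - t) - S t g x\<bar> \<le> \<bar>S m q x\<bar> + \<bar>S m g x - S t g x\<bar>"
      using quot unfolding mh by eventually_elim simp
  qed (use s m q fg in \<open>auto intro!: L1_diff L1_divide S_L1\<close>)
  also have "L1_norm M (S m q) \<le> L1_norm M q"
    by (rule S_norm_le) (use m q in auto)
  also have "L1_norm M (\<lambda>x. S m g x - S t g x) \<le> L1_norm M (\<lambda>x. S h g x - g x)"
  proof (cases "s < t")
    case True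
    then show ?thesis using S_increment_norm_le[OF m s(2) fg(2)] by (simp add: m_def h_def)
  next
    case False
    then have "m = t" by (simp add: m_def)
    then show ?thesis by (simp add: L1_norm_def[of M "\<lambda>x. 0"])
  qed
  finally show ?thesis unfolding q_def h_def by simp
qed

lemma S_has_derivative:
  assumes fg: "(f, g) \<in> generator_graph M S" and t: "0 < t"
  shows "L1_has_derivative_at M (\<lambda>t. S t f) (S t g) t"
  unfolding L1_has_derivative_at_def
proof
  note L = generator_L1[OF fg]
  show "S t g \<in> L1 M" using L t by auto
  have "((\<lambda>h. L1_norm M (\<lambda>x. (S h f x - f x) / h - g x) + L1_norm M (\<lambda>x. S h g x - g x)) \<longlongrightarrow> 0 + 0) (at_right 0)"
    using generator_quotient_tendsto[OF fg] S_tendsto_0[OF L(2)]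
    unfolding L1_tendsto_def by (rule tendsto_add)
  from filterlim_compose[OF this filterlim_abs_diff[of t UNIV]]
  have lim: "((\<lambda>s. L1_norm M (\<lambda>x. (S \<bar>s - t\<bar> f x - f x) / \<bar>s - t\<bar> - g x)
      + L1_norm M (\<lambda>x. S \<bar>s - t\<bar> g x - g x)) \<longlongrightarrow> 0) (at t)"
    by simp
  have "\<forall>\<^sub>F s in at t. s \<in> {0<..}"
    using t by (intro eventually_at_in_open') auto
  then have "\<forall>\<^sub>F s in at t. 0 \<le> s \<and> s \<noteq> t"
    by (auto simp: eventually_at_filter elim!: eventually_mono)
  then have "\<forall>\<^sub>F s in at t. L1_norm M (\<lambda>x. (S s f x - S t f x) / (s - t) - S t g x)
    \<le> L1_norm M (\<lambda>x. (S \<bar>s - t\<bar> f x - f x) / \<bar>s - t\<bar> - g x) + L1_norm M (\<lambda>x. S \<bar>s - t\<bar> g x - g x)"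
    by eventually_elim (use L t in \<open>auto intro!: S_quotient_norm_le\<close>)
  from L1_tendsto_bound[OF this lim]
  show "L1_tendsto M (\<lambda>s x. (S s f x - S t f x) / (s - t)) (S t g) (at t)" .
qed

text \<open>Up to a null set \<open>S h (S t f)\<close> is \<open>S (h + t) f\<close>, so the
  estimate for difference quotients of the orbit of \<open>f\<close> applies from the right at
  \<open>t\<close>, including \<open>t = 0\<close>.\<close>

lemma generator_S:
  assumes fg: "(f, g) \<in> generator_graph M S" and t: "0 \<le> t"
  shows "(S t f, S t g) \<in> generator_graph M S"
proof -
  note L = generator_L1[OF fg]
  have "((\<lambda>h. L1_norm M (\<lambda>x. (S h f x - f x) / h - g x) + L1_norm M (\<lambda>x. S h g x - g x)) \<longlongrightarrow> 0 + 0) (at_right 0)"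
    using generator_quotient_tendsto[OF fg] S_tendsto_0[OF L(2)]
    unfolding L1_tendsto_def by (rule tendsto_add)
  moreover have "\<forall>\<^sub>F h in at_right 0. L1_norm M (\<lambda>x. (S h (S t f) x - S t f x) / h - S t g x)
      \<le> L1_norm M (\<lambda>x. (S h f x - f x) / h - g x) + L1_norm M (\<lambda>x. S h g x - g x)"
    using eventually_at_right_less[of 0]
  proof eventually_elim
    case (elim h)
    have "AE x in M. S (h + t) f x = S h (S t f) x"
      by (rule S_add) (use elim t L in auto)
    then have "L1_norm M (\<lambda>x. (S h (S t f) x - S t f x) / h - S t g x)
        = L1_norm M (\<lambda>x. (S (h + t) f x - S t f x) / h - S t g x)"
      by (intro L1_norm_cong)
        (use elim t L in \<open>auto intro!: L1_diff L1_divide S_L1 elim!: eventually_mono\<close>)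
    also have "\<dots> \<le> L1_norm M (\<lambda>x. (S h f x - f x) / h - g x) + L1_norm M (\<lambda>x. S h g x - g x)"
      using S_quotient_norm_le[OF L, of "h + t" t] elim t by simp
    finally show ?case .
  qed
  ultimately have "L1_tendsto M (\<lambda>h x. (S h (S t f) x - S t f x) / h) (S t g) (at_right 0)"
    by (intro L1_tendsto_bound) auto
  then show ?thesis
    using L t by (auto simp: generator_graph_def)
qed

section \<open>Error of the forward Euler scheme\<close>

lemma S_diff_initial_norm_le:
  assumes fg: "(f, g) \<in> generator_graph M S" and "0 < h"
  shows "L1_norm M (\<lambda>x. S h f x - f x) \<le> L1_norm M g * h"
proof -
  note L = generator_L1[OF fg]
  have "L1_norm M (\<lambda>x. S h f x - f x) = L1_norm M (\<lambda>x. S h f x - S 0 f x)"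
    by (rule L1_norm_cong) (use S_0[OF L(1)] L assms in \<open>auto intro!: L1_diff S_L1\<close>)
  also have "\<dots> \<le> L1_norm M g * h"
    by (rule L1_mean_value[of h M _ "\<lambda>t. S t g"])
      (use assms L in \<open>auto intro!: S_continuous_on S_has_derivative S_norm_le\<close>)
  finally show ?thesis .
qed

text \<open>A first-order Taylor estimate: \<open>S t f - t * g\<close> has derivative
  \<open>S t g - g\<close>, and this is at most \<open>t\<close> times the norm of \<open>k\<close>
  because \<open>g\<close> lies in the domain of the generator too. Bounding \<open>t\<close> by
  \<open>h\<close> before the mean value inequality costs only the factor 1/2.\<close>

lemma S_euler_step_norm_le:
  assumes fg: "(f, g) \<in> generator_graph M S" and gk: "(g, k) \<in> generator_graph M S" and h: "0 < h"
  shows "L1_norm M (\<lambda>x. S h f x - (f x + h * g x)) \<le> L1_norm M k * h\<^sup>2"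
proof -
  note L = generator_L1[OF fg] generator_L1[OF gk]
  define u where "u = (\<lambda>t x. S t f x - t * g x)"
  have "L1_norm M (\<lambda>x. u h x - u 0 x) \<le> (L1_norm M k * h) * h"
  proof (rule L1_mean_value[of h M u "\<lambda>t x. S t g x - g x"])
    show "L1_continuous_on M {0..h} u"
      unfolding L1_continuous_on_def
    proof (intro conjI ballI)
      fix t assume t: "t \<in> {0..h}"
      show "u t \<in> L1 M" unfolding u_def using L t by (auto intro!: L1_diff L1_scale S_L1)
      have "((\<lambda>s. L1_norm M (\<lambda>x. S s f x - S t f x)) \<longlongrightarrow> 0) (at t within {0..h})"
        using S_continuous_on[OF L(1), of "{0..h}"] t by (auto simp: L1_continuous_on_def L1_tendsto_def)
      moreover have "((\<lambda>s. \<bar>s - t\<bar> * L1_norm M g) \<longlongrightarrow> \<bar>t - t\<bar> * L1_norm M g) (at t within {0..h})"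
        by (intro tendsto_intros)
      ultimately have "((\<lambda>s. L1_norm M (\<lambda>x. S s f x - S t f x) + \<bar>s - t\<bar> * L1_norm M g) \<longlongrightarrow> 0) (at t within {0..h})"
        using tendsto_add by fastforce
      moreover have "L1_norm M (\<lambda>x. u s x - u t x) \<le> L1_norm M (\<lambda>x. S s f x - S t f x) + \<bar>s - t\<bar> * L1_norm M g"
        if "s \<in> {0..h}" for s
        unfolding L1_norm_scale[symmetric, of "s - t" M g]
      proof (rule L1_norm_le_add)
        show "AE x in M. \<bar>u s x - u t x\<bar> \<le> \<bar>S s f x - S t f x\<bar> + \<bar>(s - t) * g x\<bar>"
          unfolding u_def by (auto simp: algebra_simps abs_if)
      qed (use that t L in \<open>auto simp: u_def intro!: L1_diff L1_scale S_L1\<close>)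
      ultimately show "L1_tendsto M u (u t) (at t within {0..h})"
        by (intro L1_tendsto_bound) (auto simp: eventually_at_filter)
    qed
    show "L1_has_derivative_at M u (\<lambda>x. S t g x - g x) t" if "0 < t" "t < h" for t
      unfolding L1_has_derivative_at_def
    proof
      show "(\<lambda>x. S t g x - g x) \<in> L1 M" using that L by (auto intro!: L1_diff S_L1)
      have lim: "((\<lambda>s. L1_norm M (\<lambda>x. (S s f x - S t f x) / (s - t) - S t g x)) \<longlongrightarrow> 0) (at t)"
        using S_has_derivative[OF fg \<open>0 < t\<close>] by (simp add: L1_has_derivative_at_def L1_tendsto_def)
      have eq: "(\<lambda>x. (S s f x - S t f x) / (s - t) - S t g x) = (\<lambda>x. (u s x - u t x) / (s - t) - (S t g x - g x))"
        if "s \<noteq> t" for s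
        using that unfolding u_def by (simp add: field_simps)
      have quot: "\<forall>\<^sub>F s in at t. L1_norm M (\<lambda>x. (S s f x - S t f x) / (s - t) - S t g x)
          = L1_norm M (\<lambda>x. (u s x - u t x) / (s - t) - (S t g x - g x))"
        unfolding eventually_at_filter by (intro always_eventually allI impI arg_cong[where f = "L1_norm M"] eq)
      show "L1_tendsto M (\<lambda>s x. (u s x - u t x) / (s - t)) (\<lambda>x. S t g x - g x) (at t)"
        unfolding L1_tendsto_def
        by (rule Lim_transform_eventually[OF lim quot])
    qed
    show "L1_norm M (\<lambda>x. S t g x - g x) \<le> L1_norm M k * h" if "0 < t" "t < h" for t
    proof -
      have "L1_norm M (\<lambda>x. S t g x - g x) \<le> L1_norm M k * t"
        by (rule S_diff_initial_norm_le[OF gk that(1)])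
      also have "\<dots> \<le> L1_norm M k * h" using that by (intro mult_left_mono) auto
      finally show ?thesis .
    qed
  qed (use h in auto)
  moreover have "L1_norm M (\<lambda>x. u h x - u 0 x) = L1_norm M (\<lambda>x. S h f x - (f x + h * g x))"
    by (rule L1_norm_cong)
      (use S_0[OF L(1)] L h in \<open>auto simp: u_def intro!: L1_diff L1_scale S_L1 L1_add\<close>)
  ultimately show ?thesis by (simp add: power2_eq_square)
qed

text \<open>Errors are accumulated, not amplified: \<open>S h\<close> contracts the error made so
  far, and contractivity of \<open>T\<close> on \<open>V\<close> keeps every iterate below the norm
  of \<open>f\<close>, so each step adds at most \<open>E\<close> times that norm.\<close>

lemma S_euler_norm_le:
  assumes h: "0 < h"
    and inv: "\<And>g. g \<in> V \<Longrightarrow> T g \<in> V" and VL: "V \<subseteq> L1 M"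
    and step: "\<And>g. g \<in> V \<Longrightarrow> L1_norm M (\<lambda>x. S h g x - T g x) \<le> E * L1_norm M g"
    and contr: "\<And>g. g \<in> V \<Longrightarrow> L1_norm M (T g) \<le> L1_norm M g"
    and f: "f \<in> V" and E: "0 \<le> E"
  shows "L1_norm M (\<lambda>x. S (real n * h) f x - (T ^^ n) f x) \<le> real n * (E * L1_norm M f)"
proof (induction n)
  case 0
  have "L1_norm M (\<lambda>x. S 0 f x - f x) = L1_norm M (\<lambda>x. 0)"
    using f VL S_0[of f] by (intro L1_norm_cong) (auto intro!: L1_diff S_L1 simp: zero_L1)
  then show ?case by (simp add: L1_norm_def)
next
  case (Suc n)
  have Tn: "(T ^^ n) f \<in> V \<and> L1_norm M ((T ^^ n) f) \<le> L1_norm M f" for n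
  proof (induction n)
    case (Suc n)
    then show ?case using inv contr[of "(T ^^ n) f"] by auto
  qed (use f in auto)
  define p where "p = (T ^^ n) f"
  have p: "p \<in> V" "p \<in> L1 M" "L1_norm M p \<le> L1_norm M f" using Tn[of n] VL by (auto simp: p_def)
  have fL: "f \<in> L1 M" using f VL by auto
  have Tp: "T p \<in> L1 M" using inv[OF p(1)] VL by auto
  have nh: "0 \<le> real n * h" using h by simp
  have "AE x in M. S (h + real n * h) f x = S h (S (real n * h) f) x"
    by (rule S_add) (use h nh fL in auto)
  then have "L1_norm M (\<lambda>x. S (real (Suc n) * h) f x - T p x)
    \<le> L1_norm M (\<lambda>x. S h (S (real n * h) f) x - S h p x) + L1_norm M (\<lambda>x. S h p x - T p x)"
    using h nh p fL Tp
    by (intro L1_norm_le_add) (auto simp: algebra_simps intro!: L1_diff S_L1 elim!: eventually_mono)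
  also have "L1_norm M (\<lambda>x. S h (S (real n * h) f) x - S h p x) \<le> L1_norm M (\<lambda>x. S (real n * h) f x - p x)"
    by (rule S_diff_norm_le) (use h nh p fL in auto)
  also have "\<dots> \<le> real n * (E * L1_norm M f)"
    using Suc.IH by (simp add: p_def)
  also have "L1_norm M (\<lambda>x. S h p x - T p x) \<le> E * L1_norm M f"
    using step[OF p(1)] mult_left_mono[OF p(3) E] by linarith
  finally show ?case by (simp add: p_def algebra_simps)
qed

section \<open>Uniqueness of classical solutions\<close>

lemma unique_solution:
  assumes cont: "L1_continuous_on M {0..} v"
    and der: "\<And>t. 0 < t \<Longrightarrow> L1_has_derivative_at M v (v' t) t"
    and gen: "\<And>t. 0 < t \<Longrightarrow> (v t, v' t) \<in> generator_graph M S"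
    and t: "0 < t"
  shows "AE x in M. v t x = S t (v 0) x"
proof -
  have vL: "v s \<in> L1 M" if "0 \<le> s" for s
    using cont that by (auto simp: L1_continuous_on_def)
  have v'L: "v' s \<in> L1 M" if "0 < s" for s
    using generator_L1[OF gen[OF that]] by auto
  define w where "w = (\<lambda>s. S (t - s) (v s))"
  have wL: "w s \<in> L1 M" if "s \<in> {0..t}" for s
    unfolding w_def using that vL by auto
  \<comment> \<open>The value \<open>v 0\<close> need not lie in the domain of the generator. The
    mean value inequality tolerates this: it asks for derivatives in the open interval only, and for
    mere continuity at its ends.\<close>
  have "L1_norm M (\<lambda>x. w t x - w 0 x) \<le> 0 * t"
  proof (rule L1_mean_value[OF t, of M w "\<lambda>s x. 0"])
    show "L1_continuous_on M {0..t} w"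
      unfolding L1_continuous_on_def
    proof (intro conjI ballI)
      fix s assume s: "s \<in> {0..t}"
      then show "w s \<in> L1 M" by (rule wL)
      have "((\<lambda>r. L1_norm M (\<lambda>x. v r x - v s x)) \<longlongrightarrow> 0) (at s within {0..t})"
        using cont s unfolding L1_continuous_on_def L1_tendsto_def
        by (auto intro: tendsto_within_subset)
      moreover have "((\<lambda>r. L1_norm M (\<lambda>x. S \<bar>r - s\<bar> (v s) x - v s x)) \<longlongrightarrow> 0) (at s within {0..t})"
        using filterlim_compose[OF S_tendsto_0[OF vL, unfolded L1_tendsto_def] filterlim_abs_diff] s by auto
      ultimately have "((\<lambda>r. L1_norm M (\<lambda>x. v r x - v s x) + L1_norm M (\<lambda>x. S \<bar>r - s\<bar> (v s) x - v s x)) \<longlongrightarrow> 0)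
          (at s within {0..t})"
        using tendsto_add by fastforce
      moreover have "L1_norm M (\<lambda>x. w r x - w s x)
          \<le> L1_norm M (\<lambda>x. v r x - v s x) + L1_norm M (\<lambda>x. S \<bar>r - s\<bar> (v s) x - v s x)"
        if r: "r \<in> {0..t}" for r
      proof -
        have "L1_norm M (\<lambda>x. w r x - w s x)
          \<le> L1_norm M (\<lambda>x. S (t - r) (v r) x - S (t - r) (v s) x)
            + L1_norm M (\<lambda>x. S (t - r) (v s) x - S (t - s) (v s) x)"
          by (rule L1_norm_le_add) (use r s vL in \<open>auto simp: w_def intro!: L1_diff S_L1\<close>)
        also have "L1_norm M (\<lambda>x. S (t - r) (v r) x - S (t - r) (v s) x) \<le> L1_norm M (\<lambda>x. v r x - v s x)"
          by (rule S_diff_norm_le) (use r s vL in auto)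
        also have "L1_norm M (\<lambda>x. S (t - r) (v s) x - S (t - s) (v s) x)
          \<le> L1_norm M (\<lambda>x. S \<bar>r - s\<bar> (v s) x - v s x)"
          using S_increment_norm_le[of "t - r" "t - s" "v s"] r s vL by (simp add: abs_minus_commute)
        finally show ?thesis by simp
      qed
      ultimately show "L1_tendsto M w (w s) (at s within {0..t})"
        by (intro L1_tendsto_bound) (auto simp: eventually_at_filter)
    qed
    fix s assume s: "0 < s" "s < t"
    show "L1_norm M (\<lambda>x. 0) \<le> 0" by (simp add: L1_norm_def)
    note fg = gen[OF s(1)]
    \<comment> \<open>The three terms are the defects in differentiability of \<open>v\<close> at
      \<open>s\<close>, in continuity of the orbit of \<open>v' s\<close>, and in differentiability
      of the orbit of \<open>v s\<close> at time \<open>t - s\<close>. The denominator of the last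
      one is left unsimplified to match the substitution of \<open>t - r\<close> into the limit at
      \<open>t - s\<close>.\<close>
    have lim: "((\<lambda>r. L1_norm M (\<lambda>x. (v r x - v s x) / (r - s) - v' s x)
        + (L1_norm M (\<lambda>x. S \<bar>r - s\<bar> (v' s) x - v' s x)
        + L1_norm M (\<lambda>x. (S (t - r) (v s) x - S (t - s) (v s) x) / ((t - r) - (t - s)) - S (t - s) (v' s) x)))
        \<longlongrightarrow> 0 + (0 + 0)) (at s)"
    proof (intro tendsto_add)
      show "((\<lambda>r. L1_norm M (\<lambda>x. (v r x - v s x) / (r - s) - v' s x)) \<longlongrightarrow> 0) (at s)"
        using der[OF s(1)] by (simp add: L1_has_derivative_at_def L1_tendsto_def)
      show "((\<lambda>r. L1_norm M (\<lambda>x. S \<bar>r - s\<bar> (v' s) x - v' s x)) \<longlongrightarrow> 0) (at s)"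
        using filterlim_compose[OF S_tendsto_0[OF v'L[OF s(1)], unfolded L1_tendsto_def] filterlim_abs_diff] .
      have "((\<lambda>r. t - r) \<longlongrightarrow> t - s) (at s)"
        by (intro tendsto_intros)
      then have "filterlim (\<lambda>r. t - r) (at (t - s)) (at s)"
        by (auto simp: filterlim_at eventually_at_filter)
      moreover have "((\<lambda>r. L1_norm M (\<lambda>x. (S r (v s) x - S (t - s) (v s) x) / (r - (t - s)) - S (t - s) (v' s) x))
          \<longlongrightarrow> 0) (at (t - s))"
        using S_has_derivative[OF fg, of "t - s"] s by (simp add: L1_has_derivative_at_def L1_tendsto_def)
      ultimately show "((\<lambda>r. L1_norm M (\<lambda>x. (S (t - r) (v s) x - S (t - s) (v s) x) / ((t - r) - (t - s))
          - S (t - s) (v' s) x)) \<longlongrightarrow> 0) (at s)"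
        by (rule filterlim_compose[rotated])
    qed
    have "\<forall>\<^sub>F r in at s. r \<in> {0<..<t}"
      using s by (intro eventually_at_in_open') auto
    then have "\<forall>\<^sub>F r in at s. 0 < r \<and> r < t \<and> r \<noteq> s"
      by (auto simp: eventually_at_filter elim!: eventually_mono)
    then have ev: "\<forall>\<^sub>F r in at s. L1_norm M (\<lambda>x. (w r x - w s x) / (r - s) - 0) \<le>
        L1_norm M (\<lambda>x. (v r x - v s x) / (r - s) - v' s x)
        + (L1_norm M (\<lambda>x. S \<bar>r - s\<bar> (v' s) x - v' s x)
        + L1_norm M (\<lambda>x. (S (t - r) (v s) x - S (t - s) (v s) x) / ((t - r) - (t - s)) - S (t - s) (v' s) x))"
    proof eventually_elim
      case (elim r)
      note L = vL[of r] vL[of s] v'L[OF s(1)]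
      define q where "q = (\<lambda>x. (v r x - v s x) / (r - s) - v' s x)"
      define e where "e = (\<lambda>x. (S (t - r) (v s) x - S (t - s) (v s) x) / ((t - r) - (t - s)) - S (t - s) (v' s) x)"
      define d where "d = (\<lambda>x. S (t - r) (v' s) x - S (t - s) (v' s) x)"
      have q: "q \<in> L1 M" unfolding q_def using L elim s by (auto intro!: L1_diff L1_divide)
      have e: "e \<in> L1 M" unfolding e_def using L elim s by (auto intro!: L1_diff L1_divide S_L1)
      have d: "d \<in> L1 M" unfolding d_def using L elim s by (auto intro!: L1_diff S_L1)
      have "AE x in M. S (t - r) (\<lambda>x. (1 / (r - s)) * (v r x - v s x) + (-1) * v' s x) x
          = (1 / (r - s)) * S (t - r) (\<lambda>x. v r x - v s x) x + (-1) * S (t - r) (v' s) x"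
        by (rule S_lincomb) (use L elim s in auto)
      moreover have "AE x in M. S (t - r) (\<lambda>x. v r x - v s x) x = S (t - r) (v r) x - S (t - r) (v s) x"
        by (rule S_diff) (use L elim s in auto)
      moreover have "(\<lambda>x. (1 / (r - s)) * (v r x - v s x) + (-1) * v' s x) = q"
        by (auto simp: q_def)
      ultimately have Sq: "AE x in M. S (t - r) q x
          = (S (t - r) (v r) x - S (t - r) (v s) x) / (r - s) - S (t - r) (v' s) x"
        by (auto elim!: eventually_elim2)
      \<comment> \<open>Insert \<open>S (t - r) (v s)\<close> between \<open>w r\<close> and
        \<open>w s\<close>. One half is \<open>S (t - r)\<close> applied to a quotient of
        \<open>v\<close>; the other is an orbit quotient with reversed sign. Their main parts
        \<open>S (t - r) (v' s)\<close> and \<open>S (t - s) (v' s)\<close> cancel up to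
        \<open>d\<close>.\<close>
      have "AE x in M. (w r x - w s x) / (r - s) = S (t - r) q x + d x - e x"
        using Sq
      proof eventually_elim
        case (elim x)
        have "(A - B) / (r - s) = (A - C) / (r - s) - (C - B) / ((t - r) - (t - s))" for A B C :: real
        proof -
          have "(t - r) - (t - s) = - (r - s)" by simp
          then show ?thesis
            by (simp only: divide_minus_right diff_minus_eq_add add_divide_distrib[symmetric]) simp
        qed
        from this[of "w r x" "w s x" "S (t - r) (v s) x"]
        show ?case using elim by (simp add: w_def d_def e_def)
      qed
      then have w_le: "AE x in M. \<bar>(w r x - w s x) / (r - s) - 0\<bar> \<le> \<bar>S (t - r) q x\<bar> + \<bar>d x - e x\<bar>"
        by eventually_elim linarith
      have "L1_norm M (\<lambda>x. (w r x - w s x) / (r - s) - 0)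
          \<le> L1_norm M (S (t - r) q) + L1_norm M (\<lambda>x. d x - e x)"
        by (rule L1_norm_le_add[OF _ _ _ w_le])
          (use q e d L elim s in \<open>auto simp: w_def intro!: L1_diff L1_divide S_L1\<close>)
      also have "L1_norm M (S (t - r) q) \<le> L1_norm M q"
        by (rule S_norm_le) (use q elim in auto)
      also have "L1_norm M (\<lambda>x. d x - e x) \<le> L1_norm M d + L1_norm M e"
        by (rule L1_norm_le_add) (use e d in auto)
      also have "L1_norm M d \<le> L1_norm M (\<lambda>x. S \<bar>r - s\<bar> (v' s) x - v' s x)"
        unfolding d_def using S_increment_norm_le[of "t - r" "t - s" "v' s"] elim s L
        by (simp add: abs_minus_commute)
      finally show ?case by (simp add: q_def e_def)
    qed
    show "L1_has_derivative_at M w (\<lambda>x. 0) s"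
      unfolding L1_has_derivative_at_def
      using L1_tendsto_bound[OF ev] lim by (auto simp: L1_def)
  qed
  then have "L1_norm M (\<lambda>x. w t x - w 0 x) = 0" by (simp add: antisym)
  moreover have "(\<lambda>x. w t x - w 0 x) \<in> L1 M" using wL t by auto
  ultimately have "AE x in M. w t x = w 0 x" using L1_norm_eq_0_AE by fastforce
  moreover have "AE x in M. w t x = v t x"
    using S_0[OF vL, of t] t by (simp add: w_def)
  ultimately show ?thesis by (auto simp: w_def elim!: eventually_elim2)
qed

end

section \<open>The gain operator\<close>

text \<open>Lebesgue measurable functions are traded for Borel ones because Tonelli's theorem is
  available for products of \<open>lborel\<close>, not for its completion. Outside \<open>A\<close>
  nothing is known about \<open>f\<close>, hence the guarded equality.\<close>

lemma ex_borel_version: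
  fixes f :: "'a::euclidean_space \<Rightarrow> real"
  assumes "f \<in> borel_measurable (lebesgue_on A)" "A \<in> sets lebesgue"
  obtains g where "g \<in> borel_measurable borel" "AE x in lborel. x \<in> A \<longrightarrow> f x = g x"
proof -
  have "(\<lambda>x. if x \<in> A then f x else 0) \<in> borel_measurable lebesgue"
    using assms by (simp add: borel_measurable_if)
  from completion_ex_borel_measurable_real[OF this]
  obtain g where "g \<in> borel_measurable borel" "AE x in lborel. (if x \<in> A then f x else 0) = g x"
    by auto
  then show ?thesis
    by (intro that[of g]) (auto elim!: eventually_mono split: if_splits)
qed

lemma borel_measurable_lebesgue_on_AE:
  fixes f g :: "'a::euclidean_space \<Rightarrow> real"
  assumes "g \<in> borel_measurable borel" "AE x in lborel. x \<in> A \<longrightarrow> f x = g x" "A \<in> sets lebesgue"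
  shows "f \<in> borel_measurable (lebesgue_on A)"
proof -
  have "(\<lambda>x. if x \<in> A then g x else 0) \<in> borel_measurable lebesgue"
    using assms by (simp add: borel_measurable_if measurable_completion measurable_restrict_space1)
  then have "(\<lambda>x. if x \<in> A then f x else 0) \<in> borel_measurable lebesgue"
    by (rule borel_measurable_AE) (use assms(2) in \<open>auto simp: AE_completion_iff elim!: eventually_mono\<close>)
  then show ?thesis
    using assms by (simp add: borel_measurable_if)
qed

lemma AE_lebesgue_on_iff:
  "A \<in> sets lebesgue \<Longrightarrow> (AE x in lebesgue_on A. P x) \<longleftrightarrow> (AE x in lborel. x \<in> A \<longrightarrow> P x)"
  by (simp add: AE_restrict_space_iff AE_completion_iff)

section \<open>Integrals and null sets of a weight\<close>

lemma measurable_weighted_iff: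
  "f \<in> borel_measurable (weighted w) \<longleftrightarrow> f \<in> borel_measurable (lebesgue_on {0<..})"
  by (simp add: weighted_def)

lemma AE_weighted_iff:
  assumes "w \<in> borel_measurable (lebesgue_on {0<..})"
  shows "(AE x in weighted w. P x) \<longleftrightarrow> (AE x in lborel. 0 < x \<longrightarrow> 0 < w x \<longrightarrow> P x)"
  unfolding weighted_def using assms by (simp add: AE_density AE_lebesgue_on_iff)

lemma nn_integral_weighted:
  assumes "w \<in> borel_measurable (lebesgue_on {0<..})" "g \<in> borel_measurable (lebesgue_on {0<..})"
  shows "(\<integral>\<^sup>+x. g x \<partial>weighted w) = (\<integral>\<^sup>+x. ennreal (w x) * g x * indicator {0<..} x \<partial>lborel)"
  unfolding weighted_def using assms
  by (simp add: nn_integral_density nn_integral_restrict_space nn_integral_completion)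

lemma in_X_iff:
  assumes "w \<in> borel_measurable (lebesgue_on {0<..})"
  shows "f \<in> X w \<longleftrightarrow> f \<in> borel_measurable (lebesgue_on {0<..}) \<and>
    (\<integral>\<^sup>+x. ennreal (w x) * ennreal \<bar>f x\<bar> * indicator {0<..} x \<partial>lborel) < \<infinity>"
  using assms
  by (auto simp: L1_def integrable_iff_bounded measurable_weighted_iff nn_integral_weighted)

lemma ennreal_L1_norm:
  assumes "w \<in> borel_measurable (lebesgue_on {0<..})" "f \<in> X w"
  shows "ennreal (L1_norm (weighted w) f)
    = (\<integral>\<^sup>+x. ennreal (w x) * ennreal \<bar>f x\<bar> * indicator {0<..} x \<partial>lborel)"
proof -
  have "ennreal (L1_norm (weighted w) f) = (\<integral>\<^sup>+x. ennreal \<bar>f x\<bar> \<partial>weighted w)"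
    unfolding L1_norm_def using assms(2) by (subst nn_integral_eq_integral) (auto simp: L1_def)
  moreover have "(\<lambda>x. ennreal \<bar>f x\<bar>) \<in> borel_measurable (lebesgue_on {0<..})"
    using in_X_iff[OF assms(1), of f] assms(2) by auto
  ultimately show ?thesis
    by (simp only: nn_integral_weighted[OF assms(1)])
qed

text \<open>The weight is a parameter because all estimates are used twice, for
  \<open>\<omega>\<close> and for \<open>(1 + c) \<omega>\<close>. The kernel bound with constant 1
  says that breaking a particle of size \<open>y\<close> does not increase the total weight.\<close>

locale fragmentation =
  fixes a w :: "real \<Rightarrow> real" and b :: "real \<Rightarrow> real \<Rightarrow> real"
  assumes a_meas: "a \<in> borel_measurable (lebesgue_on {0<..})"
    and a_nonneg: "AE x in lborel. 0 < x \<longrightarrow> 0 \<le> a x"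
    and b_meas: "(\<lambda>(x, y). b x y) \<in> borel_measurable (lebesgue_on ({0<..} \<times> {0<..}))"
    and b_nonneg: "\<And>x y. 0 < x \<Longrightarrow> 0 < y \<Longrightarrow> 0 \<le> b x y"
    and w_meas: "w \<in> borel_measurable (lebesgue_on {0<..})"
    and w_nonneg: "\<And>x. 0 < x \<Longrightarrow> 0 \<le> w x"
    and kernel_bound: "AE y in lborel. 0 < y \<longrightarrow>
      (\<integral>\<^sup>+x\<in>{0<..<y}. ennreal (b x y * w x) \<partial>lborel) \<le> ennreal (w y)"
begin

text \<open>Both orders of the quantifiers are needed: sections in \<open>y\<close> enter the
  definition of \<open>B_op\<close>, sections in \<open>x\<close> the kernel bound.\<close>

lemma ex_borel_kernel:
  obtains b' where "(\<lambda>(x, y). b' x y) \<in> borel_measurable (lborel \<Otimes>\<^sub>M lborel)"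
    "AE x in lborel. 0 < x \<longrightarrow> (AE y in lborel. 0 < y \<longrightarrow> b x y = b' x y)"
    "AE y in lborel. 0 < y \<longrightarrow> (AE x in lborel. 0 < x \<longrightarrow> b x y = b' x y)"
proof -
  have pos: "{0<..} \<times> {0<..} \<in> sets (lebesgue :: (real \<times> real) measure)"
    by (intro sets_completionI_sets) (simp add: open_Times borel_open)
  from ex_borel_version[OF b_meas pos] obtain g where g: "g \<in> borel_measurable borel"
    "AE z in lborel. z \<in> {0<..} \<times> {0<..} \<longrightarrow> (case z of (x, y) \<Rightarrow> b x y) = g z"
    by blast
  have *: "AE z in lborel \<Otimes>\<^sub>M lborel. 0 < fst z \<longrightarrow> 0 < snd z \<longrightarrow> b (fst z) (snd z) = g z"
    unfolding lborel_prod using g(2) by (auto elim!: eventually_mono)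
  have 1: "AE x in lborel. AE y in lborel. 0 < x \<longrightarrow> 0 < y \<longrightarrow> b x y = g (x, y)"
    using lborel_pair.AE_pair[OF *] by simp
  \<comment> \<open>Splitting a product null set into sections yields only one order of the
    variables; the other comes from invariance of the product measure under swapping.\<close>
  have "AE z in lborel \<Otimes>\<^sub>M lborel. 0 < snd z \<longrightarrow> 0 < fst z \<longrightarrow> b (snd z) (fst z) = g (snd z, fst z)"
  proof -
    have "AE z in distr (lborel \<Otimes>\<^sub>M lborel) (lborel \<Otimes>\<^sub>M lborel) (\<lambda>(x, y). (y, x)).
        0 < fst z \<longrightarrow> 0 < snd z \<longrightarrow> b (fst z) (snd z) = g z"
      using * by (subst lborel_pair.distr_pair_swap[symmetric])
    from AE_distrD[OF _ this] show ?thesis by (auto simp: case_prod_unfold)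
  qed
  from lborel_pair.AE_pair[OF this]
  have 2: "AE y in lborel. AE x in lborel. 0 < x \<longrightarrow> 0 < y \<longrightarrow> b x y = g (x, y)"
    by simp
  show ?thesis
  proof (rule that[of "\<lambda>x y. g (x, y)"])
    show "(\<lambda>(x, y). g (x, y)) \<in> borel_measurable (lborel \<Otimes>\<^sub>M lborel)"
      using g(1) by (simp add: lborel_prod)
    show "AE x in lborel. 0 < x \<longrightarrow> (AE y in lborel. 0 < y \<longrightarrow> b x y = g (x, y))"
      using 1 by eventually_elim auto
    show "AE y in lborel. 0 < y \<longrightarrow> (AE x in lborel. 0 < x \<longrightarrow> b x y = g (x, y))"
      using 2 by eventually_elim (auto elim!: eventually_mono)
  qed
qed

text \<open>The sections of the Lebesgue measurable function \<open>b\<close> are measurable only for almost every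
  \<open>x\<close>, hence Tonelli's theorem is applied to Borel versions of all functions involved.\<close>

lemma gain_operator:
  assumes f: "f \<in> borel_measurable (lebesgue_on {0<..})"
  obtains I :: "real \<Rightarrow> ennreal" and J :: "real \<Rightarrow> real"
  where "I \<in> borel_measurable borel" "J \<in> borel_measurable borel"
    "AE x in lborel. 0 < x \<longrightarrow> B_op a b f x = J x \<and> ennreal \<bar>J x\<bar> \<le> I x \<and>
      (I x < \<infinity> \<longrightarrow> set_integrable lebesgue {x<..} (\<lambda>y. a y * b x y * f y))"
    "(\<integral>\<^sup>+x. ennreal (w x) * I x * indicator {0<..} x \<partial>lborel)
      \<le> (\<integral>\<^sup>+y. ennreal (w y) * ennreal \<bar>a y * f y\<bar> * indicator {0<..} y \<partial>lborel)"
proof -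
  have pos: "{0<..} \<in> sets (lebesgue :: real measure)" by simp
  obtain a' where [measurable]: "a' \<in> borel_measurable borel"
    and a': "AE x in lborel. x \<in> {0<..} \<longrightarrow> a x = a' x"
    using ex_borel_version[OF a_meas pos] .
  obtain f' where [measurable]: "f' \<in> borel_measurable borel"
    and f': "AE x in lborel. x \<in> {0<..} \<longrightarrow> f x = f' x"
    using ex_borel_version[OF f pos] .
  obtain w' where [measurable]: "w' \<in> borel_measurable borel"
    and w': "AE x in lborel. x \<in> {0<..} \<longrightarrow> w x = w' x"
    using ex_borel_version[OF w_meas pos] .
  obtain b' where [measurable]: "(\<lambda>(x, y). b' x y) \<in> borel_measurable (lborel \<Otimes>\<^sub>M lborel)"
    and b1: "AE x in lborel. 0 < x \<longrightarrow> (AE y in lborel. 0 < y \<longrightarrow> b x y = b' x y)"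
    and b2: "AE y in lborel. 0 < y \<longrightarrow> (AE x in lborel. 0 < x \<longrightarrow> b x y = b' x y)"
    using ex_borel_kernel .
  have b'_sec1 [measurable]: "b' x \<in> borel_measurable borel" for x
    using measurable_Pair2'[of x lborel lborel] measurable_compose[of "Pair x" lborel "lborel \<Otimes>\<^sub>M lborel" "\<lambda>(x, y). b' x y" borel]
    by simp
  \<comment> \<open>The cut-off to \<open>0 < x < y\<close> is part of \<open>\<psi>\<close>, so
    both iterated integrals run over the whole line and can be exchanged directly.\<close>
  define \<psi> where "\<psi> = (\<lambda>x y. if 0 < x \<and> x < y then a' y * b' x y * f' y else 0)"
  have \<psi>_meas [measurable]: "(\<lambda>(x, y). \<psi> x y) \<in> borel_measurable (lborel \<Otimes>\<^sub>M lborel)"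
    unfolding \<psi>_def by measurable
  define I where "I = (\<lambda>x. \<integral>\<^sup>+y. ennreal \<bar>\<psi> x y\<bar> \<partial>lborel)"
  define J where "J = (\<lambda>x. \<integral>y. \<psi> x y \<partial>lborel)"
  have I: "I \<in> borel_measurable borel" and J: "J \<in> borel_measurable borel"
    unfolding I_def J_def by measurable
  have \<psi>_sec [measurable]: "\<psi> x \<in> borel_measurable borel" for x
    unfolding \<psi>_def by measurable
  have sec: "AE x in lborel. 0 < x \<longrightarrow> B_op a b f x = J x \<and> ennreal \<bar>J x\<bar> \<le> I x \<and>
      (I x < \<infinity> \<longrightarrow> set_integrable lebesgue {x<..} (\<lambda>y. a y * b x y * f y))"
    using b1
  proof eventually_elim
    case (elim x)
    show ?case
    proof
      assume x: "0 < x"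
      define \<phi> where "\<phi> = (\<lambda>y. indicat_real {x<..} y *\<^sub>R (a y * b x y * f y))"
      from elim x have "AE y in lborel. 0 < y \<longrightarrow> b x y = b' x y" by simp
      then have "AE y in lborel. \<psi> x y = \<phi> y"
        using a' f' by eventually_elim (use x in \<open>auto simp: \<phi>_def \<psi>_def indicator_def\<close>)
      then have ae: "AE y in lebesgue. \<psi> x y = \<phi> y" by (simp add: AE_completion_iff)
      have m1: "\<psi> x \<in> borel_measurable lebesgue" by (simp add: measurable_completion)
      have m: "\<phi> \<in> borel_measurable lebesgue"
        by (rule borel_measurable_AE[OF m1 ae])
      have "B_op a b f x = (\<integral>y. \<phi> y \<partial>lebesgue)"
        by (simp add: B_op_def set_lebesgue_integral_def \<phi>_def)
      also have "\<dots> = (\<integral>y. \<psi> x y \<partial>lebesgue)"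
        by (rule integral_cong_AE[OF m m1]) (use ae in auto)
      also have "\<dots> = J x" unfolding J_def by (simp add: integral_completion)
      finally have BJ: "B_op a b f x = J x" .
      have "(\<integral>\<^sup>+y. ennreal \<bar>\<phi> y\<bar> \<partial>lebesgue) = (\<integral>\<^sup>+y. ennreal \<bar>\<psi> x y\<bar> \<partial>lebesgue)"
        by (rule nn_integral_cong_AE) (use ae in auto)
      then have "(\<integral>\<^sup>+y. ennreal \<bar>\<phi> y\<bar> \<partial>lebesgue) = I x"
        by (simp add: nn_integral_completion I_def)
      then have "set_integrable lebesgue {x<..} (\<lambda>y. a y * b x y * f y)" if "I x < \<infinity>"
        using that m by (auto simp: set_integrable_def integrable_iff_bounded \<phi>_def)
      \<comment> \<open>If the section is not integrable, \<open>J x\<close> takes the default value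
        0 and the bound is trivial.\<close>
      moreover have "ennreal \<bar>J x\<bar> \<le> I x"
        unfolding J_def I_def using integral_norm_bound_ennreal[of lborel "\<psi> x"]
        by (cases "integrable lborel (\<psi> x)") (auto simp: not_integrable_integral_eq)
      ultimately show "B_op a b f x = J x \<and> ennreal \<bar>J x\<bar> \<le> I x \<and>
          (I x < \<infinity> \<longrightarrow> set_integrable lebesgue {x<..} (\<lambda>y. a y * b x y * f y))"
        using BJ by simp
    qed
  qed
  have "(\<integral>\<^sup>+x. ennreal (w x) * I x * indicator {0<..} x \<partial>lborel)
      = (\<integral>\<^sup>+x. ennreal (w' x) * I x * indicator {0<..} x \<partial>lborel)"
    by (rule nn_integral_cong_AE) (use w' in \<open>auto elim!: eventually_mono simp: indicator_def\<close>)
  also have "\<dots> = (\<integral>\<^sup>+x. (\<integral>\<^sup>+y. ennreal (w' x) * ennreal \<bar>\<psi> x y\<bar> \<partial>lborel) \<partial>lborel)"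
  proof (rule nn_integral_cong)
    fix x :: real
    have "(\<integral>\<^sup>+y. ennreal (w' x) * ennreal \<bar>\<psi> x y\<bar> \<partial>lborel) = ennreal (w' x) * I x"
      unfolding I_def by (rule nn_integral_cmult) measurable
    moreover have "I x = 0" if "\<not> 0 < x" using that by (simp add: I_def \<psi>_def)
    ultimately show "ennreal (w' x) * I x * indicator {0<..} x
        = (\<integral>\<^sup>+y. ennreal (w' x) * ennreal \<bar>\<psi> x y\<bar> \<partial>lborel)"
      by (auto simp: indicator_def)
  qed
  also have "\<dots> = (\<integral>\<^sup>+y. (\<integral>\<^sup>+x. ennreal (w' x) * ennreal \<bar>\<psi> x y\<bar> \<partial>lborel) \<partial>lborel)"
    by (rule lborel_pair.Fubini'[symmetric]) measurable
  \<comment> \<open>After the exchange, \<open>\<bar>a y * f y\<bar>\<close> is constant in the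
    inner integral, and what remains there is the left side of the kernel bound.\<close>
  also have "\<dots> \<le> (\<integral>\<^sup>+y. ennreal (w y) * ennreal \<bar>a y * f y\<bar> * indicator {0<..} y \<partial>lborel)"
  proof (rule nn_integral_mono_AE)
    show "AE y in lborel. (\<integral>\<^sup>+x. ennreal (w' x) * ennreal \<bar>\<psi> x y\<bar> \<partial>lborel)
        \<le> ennreal (w y) * ennreal \<bar>a y * f y\<bar> * indicator {0<..} y"
      using b2 kernel_bound a' f'
    proof eventually_elim
      case (elim y)
      show ?case
      proof (cases "0 < y")
        case True
        have b'y [measurable]: "(\<lambda>x. b' x y) \<in> borel_measurable borel"
          using measurable_compose[of "\<lambda>x. (x, y)" lborel "lborel \<Otimes>\<^sub>M lborel" "\<lambda>(x, y). b' x y" borel]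
          by simp
        from elim True have "AE x in lborel. 0 < x \<longrightarrow> b x y = b' x y" by simp
        then have eq: "AE x in lborel. ennreal (w' x) * ennreal \<bar>\<psi> x y\<bar>
            = ennreal \<bar>a y * f y\<bar> * (ennreal (b' x y * w' x) * indicator {0<..<y} x)
          \<and> ennreal (b' x y * w' x) * indicator {0<..<y} x = ennreal (b x y * w x) * indicator {0<..<y} x"
          using w'
        proof eventually_elim
          case (elim x)
          show ?case
          proof (cases "0 < x \<and> x < y")
            case xy: True
            then have "b' x y \<ge> 0" "w' x \<ge> 0" "b' x y = b x y" "w' x = w x"
              using elim b_nonneg[of x y] w_nonneg[of x] by auto
            then show ?thesis
              using xy \<open>0 < y\<close> \<open>y \<in> {0<..} \<longrightarrow> a y = a' y\<close> \<open>y \<in> {0<..} \<longrightarrow> f y = f' y\<close>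
              by (auto simp: \<psi>_def abs_mult ennreal_mult ac_simps)
          qed (auto simp: \<psi>_def indicator_def)
        qed
        have "(\<integral>\<^sup>+x. ennreal (w' x) * ennreal \<bar>\<psi> x y\<bar> \<partial>lborel)
            = (\<integral>\<^sup>+x. ennreal \<bar>a y * f y\<bar> * (ennreal (b' x y * w' x) * indicator {0<..<y} x) \<partial>lborel)"
          by (rule nn_integral_cong_AE) (use eq in auto)
        also have "\<dots> = ennreal \<bar>a y * f y\<bar> * (\<integral>\<^sup>+x\<in>{0<..<y}. ennreal (b' x y * w' x) \<partial>lborel)"
          by (rule nn_integral_cmult) measurable
        also have "(\<integral>\<^sup>+x\<in>{0<..<y}. ennreal (b' x y * w' x) \<partial>lborel)
            = (\<integral>\<^sup>+x\<in>{0<..<y}. ennreal (b x y * w x) \<partial>lborel)"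
          by (rule nn_integral_cong_AE) (use eq in auto)
        also have "\<dots> \<le> ennreal (w y)" using elim True by simp
        finally show ?thesis using True by (simp add: mult.commute mult_right_mono)
      next
        case False
        then have "\<psi> x y = 0" for x by (simp add: \<psi>_def)
        then show ?thesis by simp
      qed
    qed
  qed
  finally show ?thesis
    using that[OF I J sec] by blast
qed

text \<open>The gain never exceeds the loss in norm. In particular the domain of \<open>A\<close> is
  contained in that of \<open>B\<close>, including the requirement that the integral defining
  \<open>B_op\<close> exists.\<close>

lemma gain_bounded:
  assumes f: "f \<in> borel_measurable (lebesgue_on {0<..})" and af: "(\<lambda>x. a x * f x) \<in> X w"
  shows "AE x in weighted w. set_integrable lebesgue {x<..} (\<lambda>y. a y * b x y * f y)"
    and "B_op a b f \<in> X w"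
    and "L1_norm (weighted w) (B_op a b f) \<le> L1_norm (weighted w) (\<lambda>x. a x * f x)"
proof -
  obtain I J where [measurable]: "I \<in> borel_measurable borel" "J \<in> borel_measurable borel"
    and IJ: "AE x in lborel. 0 < x \<longrightarrow> B_op a b f x = J x \<and> ennreal \<bar>J x\<bar> \<le> I x \<and>
      (I x < \<infinity> \<longrightarrow> set_integrable lebesgue {x<..} (\<lambda>y. a y * b x y * f y))"
    and I_le: "(\<integral>\<^sup>+x. ennreal (w x) * I x * indicator {0<..} x \<partial>lborel)
      \<le> (\<integral>\<^sup>+y. ennreal (w y) * ennreal \<bar>a y * f y\<bar> * indicator {0<..} y \<partial>lborel)"
    using gain_operator[OF f] by blast
  have fin: "(\<integral>\<^sup>+y. ennreal (w y) * ennreal \<bar>a y * f y\<bar> * indicator {0<..} y \<partial>lborel) < \<infinity>"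
    using af in_X_iff[OF w_meas] by simp
  have I_leb: "I \<in> borel_measurable (lebesgue_on {0<..})"
    by (simp add: measurable_completion measurable_restrict_space1)
  have "(\<integral>\<^sup>+x. I x \<partial>weighted w) \<noteq> \<infinity>"
    using I_le fin by (simp add: nn_integral_weighted[OF w_meas I_leb])
  \<comment> \<open>A finite weighted integral controls \<open>I\<close> only where \<open>w\<close>
    is positive, which is all that \<open>B_dom\<close> asks for.\<close>
  then have "AE x in weighted w. I x \<noteq> \<infinity>"
    by (intro nn_integral_PInf_AE) (auto simp: weighted_def I_leb)
  then have "AE x in lborel. 0 < x \<longrightarrow> 0 < w x \<longrightarrow> I x \<noteq> \<infinity>"
    by (simp add: AE_weighted_iff[OF w_meas])
  with IJ show "AE x in weighted w. set_integrable lebesgue {x<..} (\<lambda>y. a y * b x y * f y)"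
    unfolding AE_weighted_iff[OF w_meas]
    by eventually_elim (auto simp: less_top)
  have B_meas: "B_op a b f \<in> borel_measurable (lebesgue_on {0<..})"
    by (rule borel_measurable_lebesgue_on_AE[of J]) (use IJ in \<open>auto elim!: eventually_mono\<close>)
  have le: "(\<integral>\<^sup>+x. ennreal (w x) * ennreal \<bar>B_op a b f x\<bar> * indicator {0<..} x \<partial>lborel)
      \<le> (\<integral>\<^sup>+y. ennreal (w y) * ennreal \<bar>a y * f y\<bar> * indicator {0<..} y \<partial>lborel)"
    by (rule order_trans[OF nn_integral_mono_AE I_le])
      (use IJ in \<open>auto elim!: eventually_mono simp: indicator_def intro!: mult_left_mono\<close>)
  show BX: "B_op a b f \<in> X w"
    unfolding in_X_iff[OF w_meas] using B_meas le fin by auto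
  show "L1_norm (weighted w) (B_op a b f) \<le> L1_norm (weighted w) (\<lambda>x. a x * f x)"
    using le unfolding ennreal_L1_norm[OF w_meas BX, symmetric] ennreal_L1_norm[OF w_meas af, symmetric]
    by simp
qed

lemma AB_dom_I:
  assumes "f \<in> X w" "(\<lambda>x. a x * f x) \<in> X w"
  shows "f \<in> AB_dom w a b"
proof -
  have "f \<in> borel_measurable (lebesgue_on {0<..})"
    using assms(1) in_X_iff[OF w_meas, of f] by simp
  from gain_bounded(1,2)[OF this assms(2)] assms show ?thesis
    by (simp add: AB_dom_def A_dom_def B_dom_def)
qed

end

section \<open>Euler approximation and invariance\<close>

lemma op_graph_subset_closure: "D \<subseteq> L1 M \<Longrightarrow> op_graph M D L \<subseteq> graph_closure M (op_graph M D L)"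
proof clarify
  fix f g assume D: "D \<subseteq> L1 M" and fg: "(f, g) \<in> op_graph M D L"
  have "L1_tendsto M (\<lambda>n::nat. h) h sequentially" for h
    by (simp add: L1_tendsto_def L1_norm_def)
  then have "\<exists>F G. (\<forall>n::nat. (F n, G n) \<in> op_graph M D L) \<and>
      L1_tendsto M F f sequentially \<and> L1_tendsto M G g sequentially"
    using fg by (intro exI[of _ "\<lambda>n. f"] exI[of _ "\<lambda>n. g"] conjI allI)
  with fg D show "(f, g) \<in> graph_closure M (op_graph M D L)"
    by (auto simp: graph_closure_def op_graph_def)
qed

lemma L1_by_domination:
  assumes "g \<in> L1 M" "f \<in> borel_measurable M" "AE x in M. \<bar>f x\<bar> \<le> \<bar>g x\<bar>"
  shows "f \<in> L1 M"
proof -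
  have "integrable M f"
    by (rule Bochner_Integration.integrable_bound[of M g]) (use assms in \<open>auto simp: L1_def\<close>)
  then show ?thesis by (simp add: L1_def)
qed

text \<open>Vanishing is required literally and not only almost everywhere with respect to
  \<open>weighted w\<close>, so that \<open>B_op a b\<close>, which also sees the zero set of \<open>w\<close>, preserves it.\<close>

definition truncated :: "(real \<Rightarrow> real) \<Rightarrow> real \<Rightarrow> (real \<Rightarrow> real) set" where
  "truncated w N = {f \<in> X w. \<forall>x>N. f x = 0}"

definition euler_step ::
  "(real \<Rightarrow> real) \<Rightarrow> (real \<Rightarrow> real \<Rightarrow> real) \<Rightarrow> real \<Rightarrow> (real \<Rightarrow> real) \<Rightarrow> real \<Rightarrow> real" where
  "euler_step a b h f = (\<lambda>x. f x + h * AB_op a b f x)"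

context fragmentation
begin

text \<open>The value of \<open>B_op a b f\<close> at \<open>x\<close> involves \<open>f\<close>
  beyond \<open>x\<close> only, so vanishing above \<open>N\<close> is inherited. Loss and gain are
  each bounded by \<open>C\<close> times the norm of \<open>f\<close>, which explains the factor
  2.\<close>

lemma truncated_bounds:
  assumes f: "f \<in> truncated w N" and C: "AE x in lborel. 0 < x \<longrightarrow> x \<le> N \<longrightarrow> a x \<le> C" "0 \<le> C"
  shows "(\<lambda>x. a x * f x) \<in> truncated w N" "B_op a b f \<in> truncated w N"
    "f \<in> AB_dom w a b" "AB_op a b f \<in> truncated w N"
    "L1_norm (weighted w) (AB_op a b f) \<le> 2 * C * L1_norm (weighted w) f"
    "0 \<le> h \<Longrightarrow> euler_step a b h f \<in> truncated w N"
    "0 \<le> h \<Longrightarrow> h * C \<le> 1 \<Longrightarrow>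
      L1_norm (weighted w) (euler_step a b h f) \<le> L1_norm (weighted w) f"
proof -
  have fX: "f \<in> X w" and f0: "\<And>x. N < x \<Longrightarrow> f x = 0"
    using f by (auto simp: truncated_def)
  have f_meas: "f \<in> borel_measurable (lebesgue_on {0<..})"
    using fX in_X_iff[OF w_meas, of f] by simp
  \<comment> \<open>Beyond \<open>N\<close> nothing bounds \<open>a\<close>; the alternative
    \<open>f x = 0\<close> takes care of that region.\<close>
  have aC: "AE x in weighted w. f x = 0 \<or> (0 \<le> a x \<and> a x \<le> C)"
    unfolding AE_weighted_iff[OF w_meas] using C(1) a_nonneg
    by eventually_elim (use f0 in \<open>auto simp: not_le[symmetric]\<close>)
  have "(\<lambda>x. C * f x) \<in> X w" using fX by auto
  then have aX: "(\<lambda>x. a x * f x) \<in> X w"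
  proof (rule L1_by_domination)
    show "(\<lambda>x. a x * f x) \<in> borel_measurable (weighted w)"
      using a_meas f_meas by (simp add: measurable_weighted_iff)
    show "AE x in weighted w. \<bar>a x * f x\<bar> \<le> \<bar>C * f x\<bar>"
      using aC by eventually_elim (auto simp: abs_mult intro: mult_right_mono)
  qed
  then show "(\<lambda>x. a x * f x) \<in> truncated w N" by (auto simp: truncated_def f0)
  have af_le: "L1_norm (weighted w) (\<lambda>x. a x * f x) \<le> C * L1_norm (weighted w) f"
  proof -
    have "L1_norm (weighted w) (\<lambda>x. a x * f x) \<le> L1_norm (weighted w) (\<lambda>x. C * f x)"
      by (rule L1_norm_mono[OF aX L1_scale[OF fX]])
        (use aC in \<open>eventually_elim, auto simp: abs_mult intro: mult_right_mono\<close>)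
    then show ?thesis using C by (simp add: L1_norm_scale)
  qed
  note B = gain_bounded[OF f_meas aX]
  show "f \<in> AB_dom w a b" by (rule AB_dom_I[OF fX aX])
  have B0: "B_op a b f x = 0" if "N < x" for x
    unfolding B_op_def set_lebesgue_integral_def
    by (rule integral_eq_zero_AE) (use that f0 in \<open>auto simp: indicator_def\<close>)
  show BT: "B_op a b f \<in> truncated w N"
    using B(2) B0 by (auto simp: truncated_def)
  have ABX: "AB_op a b f \<in> X w"
    unfolding AB_op_def A_op_def using aX B(2) by (simp add: L1_diff)
  show AB: "AB_op a b f \<in> truncated w N"
    using ABX B0 f0 by (auto simp: truncated_def AB_op_def A_op_def)
  have "L1_norm (weighted w) (AB_op a b f)
      \<le> L1_norm (weighted w) (\<lambda>x. a x * f x) + L1_norm (weighted w) (B_op a b f)"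
    by (rule L1_norm_le_add[OF aX B(2) ABX]) (auto simp: AB_op_def A_op_def)
  then show "L1_norm (weighted w) (AB_op a b f) \<le> 2 * C * L1_norm (weighted w) f"
    using B(3) af_le by simp
  show step: "euler_step a b h f \<in> truncated w N" if "0 \<le> h"
    using AB fX f0 by (auto simp: truncated_def euler_step_def)
  assume h: "0 \<le> h" "h * C \<le> 1"
  have decay: "(\<lambda>x. (1 - h * a x) * f x) \<in> X w"
    using L1_diff[OF fX L1_scale[OF aX, of h]] by (simp add: algebra_simps)
  have "L1_norm (weighted w) (euler_step a b h f)
      \<le> L1_norm (weighted w) (\<lambda>x. (1 - h * a x) * f x) + L1_norm (weighted w) (\<lambda>x. h * B_op a b f x)"
  proof (rule L1_norm_le_add[OF decay L1_scale[OF B(2)]])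
    show "euler_step a b h f \<in> X w" using step[OF h(1)] by (simp add: truncated_def)
    have "euler_step a b h f x = (1 - h * a x) * f x + h * B_op a b f x" for x
      by (simp add: euler_step_def AB_op_def A_op_def algebra_simps)
    then show "AE x in weighted w. \<bar>euler_step a b h f x\<bar> \<le> \<bar>(1 - h * a x) * f x\<bar> + \<bar>h * B_op a b f x\<bar>"
      by (simp add: abs_triangle_ineq)
  qed
  \<comment> \<open>Here an equality is essential: since \<open>0 \<le> 1 - h * a x\<close> wherever
    \<open>f\<close> does not vanish, the loss is recorded exactly and can absorb the gain. The
    triangle inequality would only give a factor above 1.\<close>
  also have "L1_norm (weighted w) (\<lambda>x. (1 - h * a x) * f x)
      = L1_norm (weighted w) f - h * L1_norm (weighted w) (\<lambda>x. a x * f x)"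
  proof -
    have "L1_norm (weighted w) (\<lambda>x. (1 - h * a x) * f x)
        = (\<integral>x. \<bar>f x\<bar> - h * \<bar>a x * f x\<bar> \<partial>weighted w)"
      unfolding L1_norm_def
    proof (rule integral_cong_AE)
      show "AE x in weighted w. \<bar>(1 - h * a x) * f x\<bar> = \<bar>f x\<bar> - h * \<bar>a x * f x\<bar>"
        using aC
      proof eventually_elim
        case (elim x)
        show ?case
        proof (cases "f x = 0")
          case False
          then have a: "0 \<le> a x" "a x \<le> C" using elim by auto
          then have "h * a x \<le> 1" using mult_left_mono[OF a(2) h(1)] h(2) by linarith
          then have "\<bar>1 - h * a x\<bar> = 1 - h * a x" "\<bar>a x\<bar> = a x" using a by simp_all
          then show ?thesis by (simp only: abs_mult) (simp add: algebra_simps)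
        qed simp
      qed
    qed (use decay fX aX in \<open>auto simp: L1_def\<close>)
    also have "\<dots> = L1_norm (weighted w) f - h * L1_norm (weighted w) (\<lambda>x. a x * f x)"
      unfolding L1_norm_def using fX aX
      by (subst Bochner_Integration.integral_diff) (auto simp: L1_def)
    finally show ?thesis .
  qed
  also have "L1_norm (weighted w) (\<lambda>x. h * B_op a b f x) \<le> h * L1_norm (weighted w) (\<lambda>x. a x * f x)"
    using B(3) h(1) by (simp add: L1_norm_scale mult_left_mono)
  finally show "L1_norm (weighted w) (euler_step a b h f) \<le> L1_norm (weighted w) f" by simp
qed

lemma euler_power_bound:
  assumes "f \<in> truncated w N" "AE x in lborel. 0 < x \<longrightarrow> x \<le> N \<longrightarrow> a x \<le> C" "0 \<le> C" "0 \<le> h" "h * C \<le> 1"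
  shows "(euler_step a b h ^^ n) f \<in> truncated w N \<and>
    L1_norm (weighted w) ((euler_step a b h ^^ n) f) \<le> L1_norm (weighted w) f"
proof (induction n)
  case (Suc n)
  then show ?case
    using truncated_bounds(6,7)[OF _ assms(2,3), of "(euler_step a b h ^^ n) f" h] assms(4,5) by auto
qed (simp add: assms(1))

text \<open>In the kernel bound \<open>x\<close> stays below \<open>y\<close>, so
  \<open>\<rho> x\<close> may be replaced by the larger constant \<open>\<rho> y\<close> and taken
  out of the integral. The intended factor is \<open>\<rho> = 1 + c\<close>.\<close>

lemma fragmentation_weight_mult:
  fixes \<rho> :: "real \<Rightarrow> real"
  assumes mono: "mono_on {0<..} \<rho>" and nonneg: "\<And>x. 0 < x \<Longrightarrow> 0 \<le> \<rho> x"
  shows "fragmentation a (\<lambda>x. \<rho> x * w x) b"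
proof
  have "(\<lambda>x. if x \<in> {0<..} then \<rho> x else 0) \<in> borel_measurable borel"
    using borel_measurable_mono_on_fnc[OF mono]
    by (subst (asm) measurable_restrict_space_iff[where c = 0]) auto
  then have "\<rho> \<in> borel_measurable (lebesgue_on {0<..})"
    by (rule borel_measurable_lebesgue_on_AE) auto
  then show "(\<lambda>x. \<rho> x * w x) \<in> borel_measurable (lebesgue_on {0<..})"
    using w_meas by simp
  show "0 \<le> \<rho> x * w x" if "0 < x" for x using that nonneg w_nonneg by simp
  have pos: "{0<..} \<in> sets (lebesgue :: real measure)" by simp
  obtain w' where [measurable]: "w' \<in> borel_measurable borel"
    and w': "AE x in lborel. x \<in> {0<..} \<longrightarrow> w x = w' x"
    using ex_borel_version[OF w_meas pos] .
  \<comment> \<open>Pulling a constant out of the integral over \<open>x\<close> needs a measurable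
    section, which \<open>b\<close> itself has only up to null sets.\<close>
  obtain b' where [measurable]: "(\<lambda>(x, y). b' x y) \<in> borel_measurable (lborel \<Otimes>\<^sub>M lborel)"
    and "AE x in lborel. 0 < x \<longrightarrow> (AE y in lborel. 0 < y \<longrightarrow> b x y = b' x y)"
    and b': "AE y in lborel. 0 < y \<longrightarrow> (AE x in lborel. 0 < x \<longrightarrow> b x y = b' x y)"
    using ex_borel_kernel .
  show "AE y in lborel. 0 < y \<longrightarrow>
      (\<integral>\<^sup>+x\<in>{0<..<y}. ennreal (b x y * (\<rho> x * w x)) \<partial>lborel) \<le> ennreal (\<rho> y * w y)"
    using b' kernel_bound
  proof eventually_elim
    case (elim y)
    show ?case
    proof
      assume y: "0 < y"
      have b'y [measurable]: "(\<lambda>x. b' x y) \<in> borel_measurable borel"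
        using measurable_compose[of "\<lambda>x. (x, y)" lborel "lborel \<Otimes>\<^sub>M lborel" "\<lambda>(x, y). b' x y" borel]
        by simp
      from elim y have "AE x in lborel. 0 < x \<longrightarrow> b x y = b' x y" by simp
      then have eq: "AE x in lborel. ennreal (b x y * w x) * indicator {0<..<y} x
          = ennreal (b' x y * w' x) * indicator {0<..<y} x"
        using w' by eventually_elim (auto simp: indicator_def)
      have "(\<integral>\<^sup>+x\<in>{0<..<y}. ennreal (b x y * (\<rho> x * w x)) \<partial>lborel)
          \<le> (\<integral>\<^sup>+x. ennreal (\<rho> y) * (ennreal (b' x y * w' x) * indicator {0<..<y} x) \<partial>lborel)"
      proof (rule nn_integral_mono_AE)
        show "AE x in lborel. ennreal (b x y * (\<rho> x * w x)) * indicator {0<..<y} x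
            \<le> ennreal (\<rho> y) * (ennreal (b' x y * w' x) * indicator {0<..<y} x)"
          using eq
        proof eventually_elim
          case (elim x)
          show ?case
          proof (cases "0 < x \<and> x < y")
            case True
            then have "\<rho> x \<le> \<rho> y" using mono by (auto simp: mono_on_def)
            moreover have "0 \<le> b x y * w x" using True b_nonneg[of x y] w_nonneg[of x] by simp
            ultimately have "b x y * (\<rho> x * w x) \<le> \<rho> y * (b x y * w x)"
              using mult_right_mono[of "\<rho> x" "\<rho> y" "b x y * w x"] by (simp add: ac_simps)
            then have "ennreal (b x y * (\<rho> x * w x)) \<le> ennreal (\<rho> y) * ennreal (b x y * w x)"
              using nonneg[OF y] \<open>0 \<le> b x y * w x\<close> by (simp add: ennreal_mult[symmetric] ennreal_leI)
            then show ?thesis using elim True by simp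
          qed (auto simp: indicator_def)
        qed
      qed
      also have "\<dots> = ennreal (\<rho> y) * (\<integral>\<^sup>+x\<in>{0<..<y}. ennreal (b' x y * w' x) \<partial>lborel)"
        by (rule nn_integral_cmult) measurable
      also have "(\<integral>\<^sup>+x\<in>{0<..<y}. ennreal (b' x y * w' x) \<partial>lborel)
          = (\<integral>\<^sup>+x\<in>{0<..<y}. ennreal (b x y * w x) \<partial>lborel)"
        by (rule nn_integral_cong_AE) (use eq in auto)
      also have "ennreal (\<rho> y) * \<dots> \<le> ennreal (\<rho> y) * ennreal (w y)"
        using elim y by (auto intro: mult_left_mono)
      also have "\<dots> = ennreal (\<rho> y * w y)"
        using nonneg[OF y] w_nonneg[OF y] by (simp add: ennreal_mult)
      finally show "(\<integral>\<^sup>+x\<in>{0<..<y}. ennreal (b x y * (\<rho> x * w x)) \<partial>lborel) \<le> ennreal (\<rho> y * w y)" .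
    qed
  qed
  show "0 \<le> b x y" if "0 < x" "0 < y" for x y using that by (rule b_nonneg)
qed (fact a_meas a_nonneg b_meas)+

end

section \<open>Comparison of weighted spaces\<close>

lemma X_mono:
  assumes "w \<in> borel_measurable (lebesgue_on {0<..})" "w' \<in> borel_measurable (lebesgue_on {0<..})"
    and "AE x in lborel. 0 < x \<longrightarrow> w x * \<bar>f x\<bar> \<le> w' x * \<bar>g x\<bar>"
    and "\<And>x. 0 < x \<Longrightarrow> 0 \<le> w x" "\<And>x. 0 < x \<Longrightarrow> 0 \<le> w' x"
    and "f \<in> borel_measurable (lebesgue_on {0<..})" "g \<in> X w'"
  shows "f \<in> X w"
  unfolding in_X_iff[OF assms(1)]
proof
  have "(\<integral>\<^sup>+x. ennreal (w x) * ennreal \<bar>f x\<bar> * indicator {0<..} x \<partial>lborel)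
      \<le> (\<integral>\<^sup>+x. ennreal (w' x) * ennreal \<bar>g x\<bar> * indicator {0<..} x \<partial>lborel)"
    by (rule nn_integral_mono_AE)
      (use assms(3) in eventually_elim, auto simp: indicator_def ennreal_mult[symmetric] assms(4,5) ennreal_leI)
  also have "\<dots> < \<infinity>" using assms(7) in_X_iff[OF assms(2), of g] by simp
  finally show "(\<integral>\<^sup>+x. ennreal (w x) * ennreal \<bar>f x\<bar> * indicator {0<..} x \<partial>lborel) < \<infinity>" .
qed fact

text \<open>Convergence in \<open>X w\<close> gives an almost everywhere convergent subsequence, and
  Fatou's lemma passes the bound in \<open>X w'\<close> to the limit; no convergence in
  \<open>X w'\<close> is claimed. The condition on the zero sets turns null sets of
  \<open>weighted w\<close> into null sets of \<open>weighted w'\<close>.\<close>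

lemma X_closed_under_bounded_limits:
  assumes w: "w \<in> borel_measurable (lebesgue_on {0<..})" and w': "w' \<in> borel_measurable (lebesgue_on {0<..})"
    and null: "\<And>x. 0 < x \<Longrightarrow> 0 < w' x \<Longrightarrow> 0 < w x"
    and q: "\<And>n. q n \<in> X w" "\<And>n. q n \<in> X w'" and f: "f \<in> X w"
    and lim: "L1_tendsto (weighted w) q f sequentially"
    and K: "\<And>n. L1_norm (weighted w') (q n) \<le> K"
  shows "f \<in> X w'"
proof -
  have "\<And>n. integrable (weighted w) (\<lambda>x. q n x - f x)"
    using L1_diff[OF q(1) f] by (simp add: L1_def)
  moreover have "(\<lambda>n. \<integral>x. norm (q n x - f x) \<partial>weighted w) \<longlonglongrightarrow> 0"
    using lim by (simp add: L1_tendsto_def L1_norm_def)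
  ultimately obtain r :: "nat \<Rightarrow> nat" where "AE x in weighted w. (\<lambda>n. q (r n) x - f x) \<longlonglongrightarrow> 0"
    using tendsto_L1_AE_subseq[of "weighted w" "\<lambda>n x. q n x - f x"] by blast
  then have r: "AE x in weighted w'. (\<lambda>n. q (r n) x - f x) \<longlonglongrightarrow> 0"
    unfolding AE_weighted_iff[OF w] AE_weighted_iff[OF w'] by (auto elim!: eventually_mono dest: null)
  have [measurable]: "f \<in> borel_measurable (weighted w')"
    using in_X_iff[OF w, of f] f by (simp add: measurable_weighted_iff)
  have [measurable]: "q n \<in> borel_measurable (weighted w')" for n
    using q(2)[of n] by (simp add: L1_def)
  have "(\<integral>\<^sup>+x. ennreal \<bar>f x\<bar> \<partial>weighted w') \<le> (\<integral>\<^sup>+x. liminf (\<lambda>n. ennreal \<bar>q (r n) x\<bar>) \<partial>weighted w')"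
  proof (rule nn_integral_mono_AE)
    show "AE x in weighted w'. ennreal \<bar>f x\<bar> \<le> liminf (\<lambda>n. ennreal \<bar>q (r n) x\<bar>)"
      using r
    proof eventually_elim
      case (elim x)
      then have "(\<lambda>n. q (r n) x) \<longlonglongrightarrow> f x" by (rule LIM_zero_cancel)
      then have "(\<lambda>n. ennreal \<bar>q (r n) x\<bar>) \<longlonglongrightarrow> ennreal \<bar>f x\<bar>"
        by (intro tendsto_ennrealI tendsto_rabs)
      from lim_imp_Liminf[OF trivial_limit_sequentially this] show ?case by simp
    qed
  qed
  also have "\<dots> \<le> liminf (\<lambda>n. \<integral>\<^sup>+x. ennreal \<bar>q (r n) x\<bar> \<partial>weighted w')"
    by (rule nn_integral_liminf) measurable
  also have "\<dots> \<le> liminf (\<lambda>n. ennreal K)"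
  proof (rule Liminf_mono, rule always_eventually, rule allI)
    fix n
    have "(\<integral>\<^sup>+x. ennreal \<bar>q (r n) x\<bar> \<partial>weighted w') = ennreal (L1_norm (weighted w') (q (r n)))"
      unfolding L1_norm_def using q(2)[of "r n"]
      by (intro nn_integral_eq_integral) (auto simp: L1_def)
    then show "(\<integral>\<^sup>+x. ennreal \<bar>q (r n) x\<bar> \<partial>weighted w') \<le> ennreal K"
      using K by (simp add: ennreal_leI)
  qed
  also have "\<dots> = ennreal K" by (simp add: Liminf_const)
  finally show ?thesis
    unfolding L1_def by (auto simp: integrable_iff_bounded le_less_trans)
qed

section \<open>Invariance of the smaller space and the Cauchy problem\<close>

locale fragmentation_semigroup =
  fragmentation a \<omega> b + substochastic "weighted \<omega>" S
  for a \<omega> :: "real \<Rightarrow> real" and b :: "real \<Rightarrow> real \<Rightarrow> real" and S +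
  assumes a_loc_bounded: "\<And>N. \<exists>C. AE x in lborel. 0 < x \<longrightarrow> x \<le> N \<longrightarrow> a x \<le> C"
    and generator: "generator_graph (weighted \<omega>) S =
      graph_closure (weighted \<omega>) (op_graph (weighted \<omega>) (AB_dom \<omega> a b) (AB_op a b))"
begin

lemma AB_in_generator:
  assumes "f \<in> AB_dom \<omega> a b" "g \<in> X \<omega>" "AE x in weighted \<omega>. g x = AB_op a b f x"
  shows "(f, g) \<in> generator_graph (weighted \<omega>) S"
proof -
  have "AB_dom \<omega> a b \<subseteq> X \<omega>" unfolding AB_dom_def A_dom_def by blast
  then have "op_graph (weighted \<omega>) (AB_dom \<omega> a b) (AB_op a b) \<subseteq> generator_graph (weighted \<omega>) S"
    unfolding generator by (rule op_graph_subset_closure)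
  moreover have "(f, g) \<in> op_graph (weighted \<omega>) (AB_dom \<omega> a b) (AB_op a b)"
    unfolding op_graph_def using assms by blast
  ultimately show ?thesis by (rule subsetD)
qed

text \<open>For truncated \<open>g\<close> the function \<open>AB_op a b g\<close> is truncated
  again, so the generator can be applied twice, with norm at most \<open>(2 * C)\<^sup>2\<close>
  times that of \<open>g\<close>. The local error is therefore of order \<open>h\<^sup>2\<close>,
  and \<open>t / h\<close> steps leave an error of order \<open>h\<close>.\<close>

lemma euler_approximation:
  assumes f: "f \<in> truncated \<omega> N" and t: "0 < t" and e: "0 < e"
    and C: "AE x in lborel. 0 < x \<longrightarrow> x \<le> N \<longrightarrow> a x \<le> C" "0 \<le> C"
  obtains n where "t / real n * C \<le> 1" "0 < n"
    "L1_norm (weighted \<omega>) (\<lambda>x. S t f x - (euler_step a b (t / real n) ^^ n) f x) \<le> e"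
proof -
  \<comment> \<open>The first summand forces \<open>h * C \<le> 1\<close> for
    \<open>h = t / real n\<close>; the second makes the accumulated error \<open>t\<^sup>2 * (2 *
    C)\<^sup>2 * L1_norm (weighted \<omega>) f / real n\<close> at most \<open>e\<close>.\<close>
  define D where "D = t * C + t\<^sup>2 * (2 * C)\<^sup>2 * L1_norm (weighted \<omega>) f / e"
  obtain n :: nat where n: "max 1 D < real n" using reals_Archimedean2 by blast
  then have n0: "0 < n" and nD: "D \<le> real n" by simp_all
  have "0 \<le> t * C" "0 \<le> t\<^sup>2 * (2 * C)\<^sup>2 * L1_norm (weighted \<omega>) f / e"
    using t C e by auto
  then have n1: "t * C \<le> real n" and n2: "t\<^sup>2 * (2 * C)\<^sup>2 * L1_norm (weighted \<omega>) f / e \<le> real n"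
    using nD unfolding D_def by linarith+
  define h where "h = t / real n"
  have h: "0 < h" "h * C \<le> 1" "real n * h = t"
    using t n0 n1 by (auto simp: h_def field_simps)
  have "L1_norm (weighted \<omega>) (\<lambda>x. S (real n * h) f x - (euler_step a b h ^^ n) f x)
      \<le> real n * ((h\<^sup>2 * (2 * C)\<^sup>2) * L1_norm (weighted \<omega>) f)"
  proof (rule S_euler_norm_le[OF h(1), of "truncated \<omega> N"])
    fix g assume g: "g \<in> truncated \<omega> N"
    note B1 = truncated_bounds[OF g C]
    note B2 = truncated_bounds[OF B1(4) C]
    show "euler_step a b h g \<in> truncated \<omega> N" using B1(6) h by simp
    show "L1_norm (weighted \<omega>) (euler_step a b h g) \<le> L1_norm (weighted \<omega>) g" using B1(7) h by simp
    have "L1_norm (weighted \<omega>) (\<lambda>x. S h g x - (g x + h * AB_op a b g x))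
        \<le> L1_norm (weighted \<omega>) (AB_op a b (AB_op a b g)) * h\<^sup>2"
      by (rule S_euler_step_norm_le[OF AB_in_generator AB_in_generator h(1)])
        (use B1(3,4) B2(3,4) in \<open>auto simp: truncated_def\<close>)
    also have "\<dots> \<le> (2 * C * (2 * C * L1_norm (weighted \<omega>) g)) * h\<^sup>2"
    proof (rule mult_right_mono)
      show "L1_norm (weighted \<omega>) (AB_op a b (AB_op a b g)) \<le> 2 * C * (2 * C * L1_norm (weighted \<omega>) g)"
        by (rule order_trans[OF B2(5) mult_left_mono[OF B1(5)]]) (use C in simp)
    qed simp
    also have "\<dots> = (h\<^sup>2 * (2 * C)\<^sup>2) * L1_norm (weighted \<omega>) g"
      by (simp add: power2_eq_square)
    finally show "L1_norm (weighted \<omega>) (\<lambda>x. S h g x - euler_step a b h g x)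
        \<le> (h\<^sup>2 * (2 * C)\<^sup>2) * L1_norm (weighted \<omega>) g"
      by (simp add: euler_step_def)
  qed (use f in \<open>auto simp: truncated_def\<close>)
  also have "\<dots> = t\<^sup>2 * (2 * C)\<^sup>2 * L1_norm (weighted \<omega>) f / real n"
    using n0 by (simp add: h_def power2_eq_square field_simps)
  also have "\<dots> \<le> e"
    using n2 n0 e by (simp add: field_simps)
  finally show ?thesis
    using that[of n] n0 h by (simp add: h_def)
qed

text \<open>A diagonal choice: \<open>p N\<close> is an Euler iterate of the truncation
  \<open>v N\<close>, with so many steps that it is within \<open>inverse (real (Suc N))\<close> of
  \<open>S t (v N)\<close> in \<open>X \<omega>\<close>. The number of steps depends on the bound
  for \<open>a\<close> up to \<open>N\<close>, but the norm of \<open>p N\<close> in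
  \<open>X w\<close> never exceeds that of \<open>u\<close>.\<close>

lemma S_invariant:
  assumes frag': "fragmentation a w b"
    and le: "\<And>x. 0 < x \<Longrightarrow> \<omega> x \<le> w x" and null: "\<And>x. 0 < x \<Longrightarrow> 0 < w x \<Longrightarrow> 0 < \<omega> x"
    and u: "u \<in> X w" and t: "0 < t"
  shows "S t u \<in> X w"
proof -
  interpret W: fragmentation a w b by fact
  have u_meas: "u \<in> borel_measurable (lebesgue_on {0<..})"
    using u in_X_iff[OF W.w_meas, of u] by simp
  have u\<omega>: "u \<in> X \<omega>"
    by (rule X_mono[OF w_meas W.w_meas _ w_nonneg W.w_nonneg u_meas u])
      (auto intro!: mult_right_mono le)
  define v where "v = (\<lambda>N::nat. \<lambda>x. if x \<le> real N then u x else 0)"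
  have v_meas: "v N \<in> borel_measurable (lebesgue_on {0<..})" for N
  proof -
    have "(\<lambda>x::real. x) \<in> borel_measurable (lebesgue_on {0<..})"
      by (simp add: measurable_completion measurable_restrict_space1)
    then show ?thesis unfolding v_def using u_meas by measurable
  qed
  have v: "v N \<in> truncated \<omega> N" "v N \<in> truncated w N" for N
    using L1_by_domination[OF u, of "v N"] L1_by_domination[OF u\<omega>, of "v N"] v_meas
    by (auto simp: truncated_def measurable_weighted_iff v_def)
  then have vX: "v N \<in> X \<omega>" "v N \<in> X w" for N by (auto simp: truncated_def)
  have "\<exists>p. p \<in> X \<omega> \<and> p \<in> X w \<and> L1_norm (weighted w) p \<le> L1_norm (weighted w) u \<and>
      L1_norm (weighted \<omega>) (\<lambda>x. S t (v N) x - p x) \<le> inverse (real (Suc N))" for N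
  proof -
    obtain C0 where "AE x in lborel. 0 < x \<longrightarrow> x \<le> real N \<longrightarrow> a x \<le> C0"
      using a_loc_bounded by blast
    then have C: "AE x in lborel. 0 < x \<longrightarrow> x \<le> real N \<longrightarrow> a x \<le> max 0 C0"
      by (auto elim!: eventually_mono)
    have C': "0 \<le> max 0 C0" by simp
    obtain n where n: "t / real n * max 0 C0 \<le> 1" "0 < n"
      "L1_norm (weighted \<omega>) (\<lambda>x. S t (v N) x - (euler_step a b (t / real n) ^^ n) (v N) x)
        \<le> inverse (real (Suc N))"
      using euler_approximation[OF v(1) t _ C C', of "inverse (real (Suc N))"] by auto
    have h: "0 \<le> t / real n" using t by simp
    have "L1_norm (weighted w) (v N) \<le> L1_norm (weighted w) u"
      by (rule L1_norm_mono[OF vX(2) u]) (auto simp: v_def)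
    then show ?thesis
      using euler_power_bound[OF v(1) C C' h n(1), of n] W.euler_power_bound[OF v(2) C C' h n(1), of n] n(3)
      by (intro exI[of _ "(euler_step a b (t / real n) ^^ n) (v N)"]) (auto simp: truncated_def)
  qed
  then obtain p where p: "\<And>N. p N \<in> X \<omega>" "\<And>N. p N \<in> X w"
    "\<And>N. L1_norm (weighted w) (p N) \<le> L1_norm (weighted w) u"
    "\<And>N. L1_norm (weighted \<omega>) (\<lambda>x. S t (v N) x - p N x) \<le> inverse (real (Suc N))"
    by metis
  have Stu: "S t u \<in> X \<omega>" using t u\<omega> by auto
  have v_lim: "(\<lambda>N. L1_norm (weighted \<omega>) (\<lambda>x. v N x - u x)) \<longlonglongrightarrow> 0"
  proof -
    have "(\<lambda>N. \<integral>x. \<bar>v N x - u x\<bar> \<partial>weighted \<omega>) \<longlonglongrightarrow> (\<integral>x. 0 \<partial>weighted \<omega>)"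
    proof (rule integral_dominated_convergence[where w = "\<lambda>x. \<bar>u x\<bar>"])
      show "AE x in weighted \<omega>. (\<lambda>N. \<bar>v N x - u x\<bar>) \<longlonglongrightarrow> 0"
      proof (rule AE_I2)
        fix x
        obtain N0 :: nat where "x \<le> real N0" using real_arch_simple by blast
        then have "\<forall>\<^sub>F N in sequentially. \<bar>v N x - u x\<bar> = 0"
          unfolding eventually_sequentially by (intro exI[of _ N0]) (auto simp: v_def)
        then show "(\<lambda>N. \<bar>v N x - u x\<bar>) \<longlonglongrightarrow> 0" by (rule tendsto_eventually)
      qed
    qed (use u\<omega> v_meas u_meas in \<open>auto simp: L1_def measurable_weighted_iff v_def\<close>)
    then show ?thesis by (simp add: L1_norm_def)
  qed
  have "L1_tendsto (weighted \<omega>) p (S t u) sequentially"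
  proof (rule L1_tendsto_bound)
    show "\<forall>\<^sub>F N in sequentially. L1_norm (weighted \<omega>) (\<lambda>x. p N x - S t u x)
        \<le> inverse (real (Suc N)) + L1_norm (weighted \<omega>) (\<lambda>x. v N x - u x)"
    proof (rule always_eventually, rule allI)
      fix N
      have "L1_norm (weighted \<omega>) (\<lambda>x. p N x - S t u x)
          \<le> L1_norm (weighted \<omega>) (\<lambda>x. S t (v N) x - p N x) + L1_norm (weighted \<omega>) (\<lambda>x. S t (v N) x - S t u x)"
        by (rule L1_norm_le_add) (use t p vX u\<omega> in \<open>auto intro!: L1_diff S_L1\<close>)
      also have "L1_norm (weighted \<omega>) (\<lambda>x. S t (v N) x - S t u x) \<le> L1_norm (weighted \<omega>) (\<lambda>x. v N x - u x)"
        by (rule S_diff_norm_le) (use t vX u\<omega> in auto)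
      finally show "L1_norm (weighted \<omega>) (\<lambda>x. p N x - S t u x)
          \<le> inverse (real (Suc N)) + L1_norm (weighted \<omega>) (\<lambda>x. v N x - u x)"
        using p(4)[of N] by linarith
    qed
    show "(\<lambda>N. inverse (real (Suc N)) + L1_norm (weighted \<omega>) (\<lambda>x. v N x - u x)) \<longlonglongrightarrow> 0"
      using tendsto_add[OF LIMSEQ_inverse_real_of_nat v_lim] by simp
  qed
  from X_closed_under_bounded_limits[OF w_meas W.w_meas null p(1,2) Stu this p(3)]
  show ?thesis by simp
qed

text \<open>For general initial values in the domain of the generator, \<open>S t u0\<close> solves
  the equation only with the closure of \<open>A + B\<close>. The assumption \<open>St\<close> puts
  the orbit into \<open>AB_dom \<omega> a b\<close> itself, and uniqueness of generator values then
  identifies its derivative \<open>S t (AB_op a b u0)\<close> with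
  \<open>AB_op a b (S t u0)\<close>.\<close>

lemma unique_classical_solution:
  assumes u0: "u0 \<in> AB_dom \<omega> a b" and St: "\<And>t. 0 < t \<Longrightarrow> S t u0 \<in> AB_dom \<omega> a b"
  shows "unique_classical_solution (weighted \<omega>) (AB_dom \<omega> a b) (AB_op a b) u0 (\<lambda>t. S t u0)"
  unfolding unique_classical_solution_def
proof (intro conjI allI impI)
  have AB_X: "AB_op a b f \<in> X \<omega>" if "f \<in> AB_dom \<omega> a b" for f
    using that by (auto simp: AB_dom_def A_dom_def B_dom_def AB_op_def A_op_def intro: L1_diff)
  have AB_gen: "(f, AB_op a b f) \<in> generator_graph (weighted \<omega>) S" if "f \<in> AB_dom \<omega> a b" for f
    using AB_in_generator[OF that AB_X[OF that]] by simp
  note gen0 = AB_gen[OF u0]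
  note L = generator_L1[OF gen0]
  show "classical_solution (weighted \<omega>) (AB_dom \<omega> a b) (AB_op a b) u0 (\<lambda>t. S t u0)"
    unfolding classical_solution_def
  proof (intro conjI exI[of _ "\<lambda>t. S t (AB_op a b u0)"] allI impI)
    fix t :: real assume t: "0 < t"
    show "L1_has_derivative_at (weighted \<omega>) (\<lambda>t. S t u0) (S t (AB_op a b u0)) t"
      by (rule S_has_derivative[OF gen0 t])
    show "S t u0 \<in> AB_dom \<omega> a b" by (rule St[OF t])
    show "AE x in weighted \<omega>. S t (AB_op a b u0) x = AB_op a b (S t u0) x"
      by (rule generator_unique[OF generator_S[OF gen0] AB_gen[OF St]]) (use t in auto)
  qed (use L S_0 in \<open>auto intro!: S_continuous_on\<close>)
  fix v and t :: real
  assume v: "classical_solution (weighted \<omega>) (AB_dom \<omega> a b) (AB_op a b) u0 v" and t: "0 \<le> t"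
  then obtain v' where cont: "L1_continuous_on (weighted \<omega>) {0..} v"
    and der: "\<And>t. 0 < t \<Longrightarrow> L1_has_derivative_at (weighted \<omega>) v (v' t) t"
    and eq: "\<And>t. 0 < t \<Longrightarrow> v t \<in> AB_dom \<omega> a b" "\<And>t. 0 < t \<Longrightarrow> AE x in weighted \<omega>. v' t x = AB_op a b (v t) x"
    and init: "AE x in weighted \<omega>. v 0 x = u0 x"
    unfolding classical_solution_def by blast
  have v0: "v 0 \<in> X \<omega>" using cont by (simp add: L1_continuous_on_def)
  show "AE x in weighted \<omega>. v t x = S t u0 x"
  proof (cases "t = 0")
    case True
    with init S_0[OF L(1)] show ?thesis by (auto elim!: eventually_elim2)
  next
    case False
    then have t: "0 < t" using t by simp
    have "AE x in weighted \<omega>. v t x = S t (v 0) x"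
      using der by (intro unique_solution[OF cont der _ t] AB_in_generator eq) (auto simp: L1_has_derivative_at_def)
    moreover have "AE x in weighted \<omega>. S t (v 0) x = S t u0 x"
      using t v0 L init by (intro S_cong) auto
    ultimately show ?thesis by (auto elim!: eventually_elim2)
  qed
qed

end

theorem corollary3p5:
  fixes a c \<omega> :: "real \<Rightarrow> real" and b :: "real \<Rightarrow> real \<Rightarrow> real" and \<kappa> :: real
    and S :: "real \<Rightarrow> (real \<Rightarrow> real) \<Rightarrow> (real \<Rightarrow> real)"
  assumes "L_inf_loc a"
    and "AE x in lebesgue_on {0<..}. 0 \<le> a x"
    and "(\<lambda>(x, y). b x y) \<in> borel_measurable (lebesgue_on ({0<..} \<times> {0<..}))"
    and "\<forall>x>0. \<forall>y>0. 0 \<le> b x y"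
    and "AE (x, y) in lebesgue_on ({0<..} \<times> {0<..}). x > y \<longrightarrow> b x y = 0"
    and "\<omega> \<in> borel_measurable (lebesgue_on {0..})"
    and "\<forall>x\<ge>0. 0 \<le> \<omega> x"
    and "0 < \<kappa>" and "\<kappa> \<le> 1"
    and "\<forall>y>0. (\<integral>\<^sup>+x\<in>{0<..<y}. ennreal (b x y * \<omega> x) \<partial>lebesgue) \<le> ennreal (\<kappa> * \<omega> y)"
    and "mono_on {0..} c"
    and "AE x in lebesgue_on {0..}. a x \<le> c x"
    and "substochastic_semigroup (weighted \<omega>) S"
    and "generator_graph (weighted \<omega>) S =
           graph_closure (weighted \<omega>) (op_graph (weighted \<omega>) (AB_dom \<omega> a b) (AB_op a b))"
  shows "(\<forall>u0 \<in> X (\<lambda>x. (1 + c x) * \<omega> x).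
            unique_classical_solution (weighted \<omega>) (AB_dom \<omega> a b) (AB_op a b) u0 (\<lambda>t. S t u0)) \<and>
         (\<forall>u0 \<in> X_pos (\<lambda>x. (1 + c x) * \<omega> x). \<forall>t\<ge>0. S t u0 \<in> X_pos \<omega>)"
proof -
  have a_meas: "a \<in> borel_measurable (lebesgue_on {0<..})"
    by (rule measurable_restrict_mono[of _ _ "{0..}"]) (use assms(1) in \<open>auto simp: L_inf_loc_def\<close>)
  have \<omega>_meas: "\<omega> \<in> borel_measurable (lebesgue_on {0<..})"
    by (rule measurable_restrict_mono[OF assms(6)]) auto
  have a_nonneg: "AE x in lborel. 0 < x \<longrightarrow> 0 \<le> a x"
    using assms(2) by (simp add: AE_lebesgue_on_iff)
  have a_le_c: "AE x in lborel. 0 < x \<longrightarrow> a x \<le> c x"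
    using assms(12) by (auto simp: AE_lebesgue_on_iff elim!: eventually_mono)
  \<comment> \<open>If \<open>c x < 0\<close>, monotonicity makes \<open>c\<close> negative on all
    of \<open>(0, x)\<close>, a set of positive measure, contradicting
    \<open>0 \<le> a \<le> c\<close> almost everywhere.\<close>
  have c_nonneg: "0 \<le> c x" if x: "0 < x" for x
  proof (rule ccontr)
    assume neg: "\<not> 0 \<le> c x"
    have c_neg: "c y < 0" if "y \<in> {0<..<x}" for y
      using mono_onD[OF assms(11), of y x] neg that by auto
    have "AE y in lborel. y \<notin> {0<..<x}"
      using a_nonneg a_le_c by eventually_elim (use c_neg in fastforce)
    then have "emeasure lborel {0<..<x} = 0"
      using AE_iff_null_sets[of "{0<..<x}" lborel] by auto
    then show False using x by simp
  qed
  interpret fragmentation_semigroup a \<omega> b S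
  proof
    show "AE y in lborel. 0 < y \<longrightarrow> (\<integral>\<^sup>+x\<in>{0<..<y}. ennreal (b x y * \<omega> x) \<partial>lborel) \<le> ennreal (\<omega> y)"
    proof (rule AE_I2, rule impI)
      fix y :: real assume y: "0 < y"
      have "\<kappa> * \<omega> y \<le> \<omega> y" using assms(7,9) y by (simp add: mult_left_le_one_le assms(8) less_imp_le)
      then show "(\<integral>\<^sup>+x\<in>{0<..<y}. ennreal (b x y * \<omega> x) \<partial>lborel) \<le> ennreal (\<omega> y)"
        using assms(10) y order_trans ennreal_leI unfolding nn_integral_completion by blast
    qed
    show "\<exists>C. AE x in lborel. 0 < x \<longrightarrow> x \<le> N \<longrightarrow> a x \<le> C" for N
    proof -
      obtain C where "AE x in lebesgue_on {0..N}. \<bar>a x\<bar> \<le> C"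
        using assms(1) unfolding L_inf_loc_def by (meson atLeastAtMost_iff atLeast_iff compact_Icc subsetI)
      then show ?thesis
        by (intro exI[of _ C]) (auto simp: AE_lebesgue_on_iff elim!: eventually_mono)
    qed
    show "0 \<le> b x y" if "0 < x" "0 < y" for x y using assms(4) that by blast
    show "0 \<le> \<omega> x" if "0 < x" for x using assms(7) that by simp
  qed (fact a_meas \<omega>_meas a_nonneg assms(3,13,14))+
  define w where "w = (\<lambda>x. (1 + c x) * \<omega> x)"
  have frag: "fragmentation a w b"
    unfolding w_def
    by (rule fragmentation_weight_mult) (use assms(11) c_nonneg in \<open>auto simp: mono_on_def\<close>)
  then interpret W: fragmentation a w b .
  have le: "\<omega> x \<le> w x" if "0 < x" for x
    using c_nonneg[OF that] w_nonneg[OF that] by (simp add: w_def algebra_simps)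
  \<comment> \<open>Together with \<open>le\<close> this says that \<open>\<omega>\<close> and
    \<open>w\<close> have the same zeros on the positive half-line, so both weights have the same
    null sets and almost everywhere statements pass in either direction.\<close>
  have null: "0 < \<omega> x" if "0 < x" "0 < w x" for x
    using that w_nonneg[of x] by (cases "\<omega> x = 0") (auto simp: w_def)
  have meas: "f \<in> borel_measurable (lebesgue_on {0<..})" if "f \<in> X w" for f
    using that in_X_iff[OF W.w_meas, of f] by simp
  have sub: "f \<in> X \<omega>" if "f \<in> X w" for f
    by (rule X_mono[OF w_meas W.w_meas _ w_nonneg W.w_nonneg meas[OF that] that])
      (auto intro!: mult_right_mono le)
  have dom: "f \<in> AB_dom \<omega> a b" if f: "f \<in> X w" for f
  proof (rule AB_dom_I[OF sub[OF f]])
    show "(\<lambda>x. a x * f x) \<in> X \<omega>"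
    proof (rule X_mono[OF w_meas W.w_meas _ w_nonneg W.w_nonneg _ f])
      show "AE x in lborel. 0 < x \<longrightarrow> \<omega> x * \<bar>a x * f x\<bar> \<le> w x * \<bar>f x\<bar>"
        using a_nonneg a_le_c
      proof eventually_elim
        case (elim x)
        show ?case
        proof
          assume x: "0 < x"
          then have "a x * (\<omega> x * \<bar>f x\<bar>) \<le> (1 + c x) * (\<omega> x * \<bar>f x\<bar>)"
            using elim w_nonneg[OF x] by (intro mult_right_mono) auto
          then show "\<omega> x * \<bar>a x * f x\<bar> \<le> w x * \<bar>f x\<bar>"
            using elim x by (simp add: w_def abs_mult ac_simps)
        qed
      qed
      show "(\<lambda>x. a x * f x) \<in> borel_measurable (lebesgue_on {0<..})"
        using a_meas meas[OF f] by (rule borel_measurable_times)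
    qed
  qed
  show ?thesis
    unfolding w_def[symmetric]
  proof (intro conjI ballI allI impI)
    fix u0 assume u0: "u0 \<in> X w"
    show "unique_classical_solution (weighted \<omega>) (AB_dom \<omega> a b) (AB_op a b) u0 (\<lambda>t. S t u0)"
      by (rule unique_classical_solution[OF dom[OF u0] dom[OF S_invariant[OF frag le null u0]]])
  next
    fix u0 and t :: real assume u0: "u0 \<in> X_pos w" and t: "0 \<le> t"
    have "u0 \<in> X_pos \<omega>"
    proof -
      have "AE x in weighted w. 0 \<le> u0 x" "u0 \<in> X w" using u0 by (auto simp: L1_pos_def)
      moreover from this(1) have "AE x in weighted \<omega>. 0 \<le> u0 x"
        unfolding AE_weighted_iff[OF w_meas] AE_weighted_iff[OF W.w_meas]
        by eventually_elim (use le in force)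
      ultimately show ?thesis using sub by (simp add: L1_pos_def)
    qed
    then show "S t u0 \<in> X_pos \<omega>" by (rule S_pos[OF t])
  qed
qed

end
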